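(* Suppose given an orthonormal basis $\{f^{\ell,r}\}$, $r=0,\dots,N-1$, $\ell=1,\dots,d_r-1$, of $\mathfrak{S}_2\ominus\mathfrak{S}_1$ constructed as described in the context. Consider the functions $$\psi^{\ell,r}_a=S_a f^{\ell,r},\qquad a=(a_1,\dots,a_k)\in\mathcal{W}_{k,A},\quad S_a=S_{a_1}\cdots S_{a_k}.$$ These give an orthonormal basis for the space $\mathfrak{S}_{k+1}\ominus\mathfrak{S}_k$. Hence, for varying $a\in\mathcal{W}_{k,A}$ and for all $k\ge 0$, they give an orthonormal basis of wavelets for $L^2(\Lambda_A,\mu_A)$.
   Context: Let $A=(A_{ij})_{i,j=0,\dots,N-1}$ be a matrix with entries in $\{0,1\}$ and $A_{ii}=1$ for all $i$. $\Lambda_A$ is the set of infinite sequences $x=(x_1x_2x_3\dots)$ with $x_i\in\{0,\dots,N-1\}$ and $A_{x_ix_{i+1}}=1$ for all $i\ge1$, identified with the subset of $[0,1]$ of numbers $\sum_{i\ge1}x_iN^{-i}$ whose $N$-adic expansion is admissible in this sense (rational numbers being identified with infinite periodic sequences rather than with finite $N$-adic expansions). $\delta_A$ is the Hausdorff dimension of $\Lambda_A\subset[0,1]$ and $\mu_A$ is the Hausdorff measure on $\Lambda_A$ in dimension $\delta_A$. $\sigma(x_1x_2x_3\dots)=(x_2x_3\dots)$ is the shift; $R_i=\{x\in\Lambda_A:x_1=i\}$, $D_i=\{x\in\Lambda_A:A_{ix_1}=1\}$, and $\sigma_i:D_i\to R_i$ is $\sigma_i(x)=ix$. $\Phi_{\sigma_i}=d(\mu_A\circ\sigma_i)/d\mu_A$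 is the Radon–Nikodym derivative on $D_i$. The operators $S_i$ on $L^2(\Lambda_A,\mu_A)$, given by $(S_if)(x)=\chi_{R_i}(x)\,\Phi_{\sigma_i}(\sigma(x))^{-1/2}f(\sigma(x))$, generate a representation of the Cuntz–Krieger algebra $O_A$ (relations $\sum_iS_iS_i^*=1$ and $S_i^*S_i=\sum_jA_{ij}S_jS_j^*$). $\mathcal{W}_{k,A}$ is the set of words $a=(a_1,\dots,a_k)$ with letters in $\{0,\dots,N-1\}$ and $A_{a_ia_{i+1}}=1$ for $1\le i\le k-1$ (for $k=0$, only the empty word, with $S_\emptyset=1$); $\Lambda_{k,A}(a)=\{x\in\Lambda_A:(x_1,\dots,x_k)=a\}$, and $R_{rj}=\Lambda_{2,A}(rj)$. $d_r=\#\{j:A_{rj}=1\}$. $\mathfrak{S}_0\subset L^2(\Lambda_A,\mu_A)$ is the space of constant functions and, for $k\ge1$, $\mathfrak{S}_k$ is the space of functions that agree $\mu_A$-almost everywhere on each set $\Lambda_{k,A}(a)$, $a\in\mathcal{W}_{k,A}$, with a constant. $\mathfrak{S}_{k+1}\ominus\mathfrak{S}_k$ is the orthogonal complement of $\mathfrak{S}_k$ in $\mathfrak{S}_{k+1}$. The basis $\{f^{\ell,r}\}$ of $\mathfrak{S}_2\ominus\mathfrak{S}_1$ consists of linear combinations $f^{\ell,r}=\sum_jA_{rj}c^{\ell,r}_j\chi_{R_{rj}}$ (so $f^{\ell,r}$ is supported in $R_r$), with coefficients chosen so that $\int_{R_r}\overline{f^{\ell,r}}f^{\ell',r}\,d\mu_A=\delta_{\ell,\ell'}$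 and $\int_{R_r}f^{\ell,r}\,d\mu_A=0$ for all $\ell$.
   Formalization: Corrected: words a of length k give a basis of S_{k+2}⊖S_{k+1}, not S_{k+1}⊖S_k; only ψ_a^{ℓ,r} with ar admissible are used (the others vanish a.e.); all k together give a basis of L²⊖S_1, and of L² once an orthonormal basis of S_1 is added. *)

theory Defs
  imports "HOL-Analysis.Analysis"
begin

section \<open>Hausdorff measure and dimension\<close>

text \<open>
  The summand \<open>diam(U)^s\<close>, with the usual convention that for \<open>s = 0\<close> every nonempty set
  contributes 1 (whereas \<open>0 powr 0 = 0\<close> in HOL).
\<close>
definition hausdorff_gauge :: "real \<Rightarrow> 'a::metric_space set \<Rightarrow> ennreal" where
  "hausdorff_gauge s U =
     (if U = {} then 0 else if s = 0 then 1 else ennreal (diameter U powr s))"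

text \<open>
  Covers are by bounded sets because \<open>diameter\<close> is unspecified on unbounded ones.
\<close>
definition hausdorff_premeasure :: "real \<Rightarrow> real \<Rightarrow> 'a::metric_space set \<Rightarrow> ennreal" where
  "hausdorff_premeasure s \<epsilon> E =
     (INF U \<in> {U :: nat \<Rightarrow> 'a set. E \<subseteq> (\<Union>n. U n) \<and> (\<forall>n. bounded (U n) \<and> diameter (U n) \<le> \<epsilon>)}.
        \<Sum>n. hausdorff_gauge s (U n))"

definition hausdorff_outer_measure :: "real \<Rightarrow> 'a::metric_space set \<Rightarrow> ennreal" where
  "hausdorff_outer_measure s E = (SUP \<epsilon> \<in> {0<..}. hausdorff_premeasure s \<epsilon> E)"

definition hausdorff_dim :: "'a::metric_space set \<Rightarrow> real" where
  "hausdorff_dim E = Inf {s. 0 \<le> s \<and> hausdorff_outer_measure s E = 0}"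

section \<open>The Cantor set of admissible sequences\<close>

text \<open>
  Sequences are indexed from 0: \<open>x 0\<close> is the first letter \<open>x\<^sub>1\<close>. Likewise for words,
  which are lists.
\<close>
definition Lam :: "nat \<Rightarrow> (nat \<Rightarrow> nat \<Rightarrow> nat) \<Rightarrow> (nat \<Rightarrow> nat) set" where
  "Lam N A = {x. \<forall>n. x n < N \<and> A (x n) (x (Suc n)) = 1}"

definition words :: "nat \<Rightarrow> (nat \<Rightarrow> nat \<Rightarrow> nat) \<Rightarrow> nat \<Rightarrow> nat list set" where
  "words N A k = {a. length a = k \<and> set a \<subseteq> {..<N} \<and>
                     (\<forall>i. Suc i < k \<longrightarrow> A (a ! i) (a ! Suc i) = 1)}"

definition cylinder :: "nat \<Rightarrow> (nat \<Rightarrow> nat \<Rightarrow> nat) \<Rightarrow> nat list \<Rightarrow> (nat \<Rightarrow> nat) set" where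
  "cylinder N A a = {x \<in> Lam N A. \<forall>i < length a. x i = a ! i}"

abbreviation Rset :: "nat \<Rightarrow> (nat \<Rightarrow> nat \<Rightarrow> nat) \<Rightarrow> nat \<Rightarrow> (nat \<Rightarrow> nat) set" where
  "Rset N A i \<equiv> cylinder N A [i]"

definition Dset :: "nat \<Rightarrow> (nat \<Rightarrow> nat \<Rightarrow> nat) \<Rightarrow> nat \<Rightarrow> (nat \<Rightarrow> nat) set" where
  "Dset N A i = {x \<in> Lam N A. A i (x 0) = 1}"

definition shift :: "(nat \<Rightarrow> nat) \<Rightarrow> nat \<Rightarrow> nat" where
  "shift x = (\<lambda>n. x (Suc n))"

definition prepend :: "nat \<Rightarrow> (nat \<Rightarrow> nat) \<Rightarrow> nat \<Rightarrow> nat" where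
  "prepend i x = case_nat i x"

definition outdeg :: "nat \<Rightarrow> (nat \<Rightarrow> nat \<Rightarrow> nat) \<Rightarrow> nat \<Rightarrow> nat" where
  "outdeg N A r = card {j. j < N \<and> A r j = 1}"

text \<open>The identification of sequences with points of the unit interval.\<close>
definition adic :: "nat \<Rightarrow> (nat \<Rightarrow> nat) \<Rightarrow> real" where
  "adic N x = (\<Sum>n. real (x n) / real N ^ Suc n)"

definition delta :: "nat \<Rightarrow> (nat \<Rightarrow> nat \<Rightarrow> nat) \<Rightarrow> real" where
  "delta N A = hausdorff_dim (adic N ` Lam N A)"

text \<open>
  The Hausdorff measure lives on the sequence space, with the sigma-algebra generated by the
  cylinders (its Borel sets), and the mass of a set is the Hausdorff measure of its image in
  the unit interval. The map \<open>adic N\<close> identifies at most countably many pairs of sequences,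
  so this is additive as soon as \<open>delta N A > 0\<close>, points then being null. If
  \<open>delta N A = 0\<close> (counting measure) and two admissible sequences have the same image, it is
  not additive and \<open>mu N A\<close> is the zero measure.
\<close>
definition mu :: "nat \<Rightarrow> (nat \<Rightarrow> nat \<Rightarrow> nat) \<Rightarrow> (nat \<Rightarrow> nat) measure" where
  "mu N A = measure_of (Lam N A) (range (cylinder N A))
              (\<lambda>E. hausdorff_outer_measure (delta N A) (adic N ` E))"

section \<open>Square integrable functions and orthonormal bases\<close>

text \<open>
  Elements of \<open>L\<^sup>2(M)\<close> are represented by functions. All notions below are invariant under
  changes on null sets; in particular the subspaces are closed under such changes.
\<close>
definition L2 :: "'a measure \<Rightarrow> ('a \<Rightarrow> complex) set" where
  "L2 M = {f \<in> borel_measurable M. integrable M (\<lambda>x. (cmod (f x))\<^sup>2)}"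

definition l2_inner :: "'a measure \<Rightarrow> ('a \<Rightarrow> complex) \<Rightarrow> ('a \<Rightarrow> complex) \<Rightarrow> complex" where
  "l2_inner M f g = (\<integral>x. cnj (f x) * g x \<partial>M)"

definition l2_norm :: "'a measure \<Rightarrow> ('a \<Rightarrow> complex) \<Rightarrow> real" where
  "l2_norm M f = sqrt (\<integral>x. (cmod (f x))\<^sup>2 \<partial>M)"

definition ominus :: "'a measure \<Rightarrow> ('a \<Rightarrow> complex) set \<Rightarrow> ('a \<Rightarrow> complex) set \<Rightarrow> ('a \<Rightarrow> complex) set"
  where "ominus M V W = {f \<in> V. \<forall>g \<in> W. l2_inner M g f = 0}"

definition orthonormal_basis ::
    "'a measure \<Rightarrow> 'i set \<Rightarrow> ('i \<Rightarrow> 'a \<Rightarrow> complex) \<Rightarrow> ('a \<Rightarrow> complex) set \<Rightarrow> bool" where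
  "orthonormal_basis M I \<phi> V \<longleftrightarrow>
     (\<forall>i\<in>I. \<phi> i \<in> V) \<and>
     (\<forall>i\<in>I. \<forall>j\<in>I. l2_inner M (\<phi> i) (\<phi> j) = (if i = j then 1 else 0)) \<and>
     (\<forall>g\<in>V. \<forall>\<epsilon>>0. \<exists>F c. finite F \<and> F \<subseteq> I \<and>
        l2_norm M (\<lambda>x. g x - (\<Sum>i\<in>F. c i * \<phi> i x)) < \<epsilon>)"

text \<open>
  The space \<open>\<SS>\<^sub>k\<close>. For \<open>k = 0\<close> the only word is empty, with cylinder \<open>Lam N A\<close>, and one gets
  the constant functions.
\<close>
definition Sspace :: "nat \<Rightarrow> (nat \<Rightarrow> nat \<Rightarrow> nat) \<Rightarrow> nat \<Rightarrow> ((nat \<Rightarrow> nat) \<Rightarrow> complex) set" where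
  "Sspace N A k = {f \<in> L2 (mu N A).
     \<forall>a \<in> words N A k. \<exists>c. AE x in mu N A. x \<in> cylinder N A a \<longrightarrow> f x = c}"

section \<open>The operators of the Cuntz--Krieger algebra\<close>

definition mu_sigma :: "nat \<Rightarrow> (nat \<Rightarrow> nat \<Rightarrow> nat) \<Rightarrow> nat \<Rightarrow> (nat \<Rightarrow> nat) measure" where
  "mu_sigma N A i = measure_of (Dset N A i) (sets (restrict_space (mu N A) (Dset N A i)))
                      (\<lambda>E. emeasure (mu N A) (prepend i ` E))"

definition Phi :: "nat \<Rightarrow> (nat \<Rightarrow> nat \<Rightarrow> nat) \<Rightarrow> nat \<Rightarrow> (nat \<Rightarrow> nat) \<Rightarrow> real" where
  "Phi N A i x = enn2real (RN_deriv (restrict_space (mu N A) (Dset N A i)) (mu_sigma N A i) x)"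

definition Sop :: "nat \<Rightarrow> (nat \<Rightarrow> nat \<Rightarrow> nat) \<Rightarrow> nat \<Rightarrow>
    ((nat \<Rightarrow> nat) \<Rightarrow> complex) \<Rightarrow> (nat \<Rightarrow> nat) \<Rightarrow> complex" where
  "Sop N A i f x =
     indicator (Rset N A i) x * complex_of_real (Phi N A i (shift x) powr (- 1 / 2)) * f (shift x)"

definition Sword :: "nat \<Rightarrow> (nat \<Rightarrow> nat \<Rightarrow> nat) \<Rightarrow> nat list \<Rightarrow>
    ((nat \<Rightarrow> nat) \<Rightarrow> complex) \<Rightarrow> (nat \<Rightarrow> nat) \<Rightarrow> complex" where
  "Sword N A a f = foldr (Sop N A) a f"

section \<open>Wavelets\<close>

definition mother_index :: "nat \<Rightarrow> (nat \<Rightarrow> nat \<Rightarrow> nat) \<Rightarrow> (nat \<times> nat) set" where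
  "mother_index N A = {(l, r). r < N \<and> 1 \<le> l \<and> l \<le> outdeg N A r - 1}"

text \<open>
  The functions \<open>f\<^sup>l\<^sup>,\<^sup>r\<close> with their coefficients \<open>c\<^sup>l\<^sup>,\<^sup>r\<^sub>j\<close>. The conditions on the integrals
  over \<open>R\<^sub>r\<close> largely overlap with the orthonormal basis property.
\<close>
definition mother_wavelets :: "nat \<Rightarrow> (nat \<Rightarrow> nat \<Rightarrow> nat) \<Rightarrow>
    (nat \<Rightarrow> nat \<Rightarrow> nat \<Rightarrow> complex) \<Rightarrow> (nat \<Rightarrow> nat \<Rightarrow> (nat \<Rightarrow> nat) \<Rightarrow> complex) \<Rightarrow> bool" where
  "mother_wavelets N A c f \<longleftrightarrow>
     orthonormal_basis (mu N A) (mother_index N A) (\<lambda>(l, r). f l r)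
       (ominus (mu N A) (Sspace N A 2) (Sspace N A 1)) \<and>
     (\<forall>(l, r) \<in> mother_index N A. \<forall>x \<in> Lam N A.
        f l r x = (\<Sum>j<N. of_nat (A r j) * c l r j * indicator (cylinder N A [r, j]) x)) \<and>
     (\<forall>l l' r. (l, r) \<in> mother_index N A \<longrightarrow> (l', r) \<in> mother_index N A \<longrightarrow>
        (LINT x : Rset N A r | mu N A. cnj (f l r x) * f l' r x) = (if l = l' then 1 else 0)) \<and>
     (\<forall>(l, r) \<in> mother_index N A. (LINT x : Rset N A r | mu N A. f l r x) = 0)"

text \<open>
  The indices \<open>(a, l, r)\<close> with \<open>a\<close> of length \<open>k\<close> for which \<open>S\<^sub>a f\<^sup>l\<^sup>,\<^sup>r\<close> is nonzero:
  \<open>S\<^sub>a f\<^sup>l\<^sup>,\<^sup>r\<close> is supported in the cylinder of the word \<open>ar\<close>, which has to be admissible.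
\<close>
definition wavelet_index :: "nat \<Rightarrow> (nat \<Rightarrow> nat \<Rightarrow> nat) \<Rightarrow> nat \<Rightarrow> (nat list \<times> nat \<times> nat) set" where
  "wavelet_index N A k =
     {(a, l, r). a \<in> words N A k \<and> (l, r) \<in> mother_index N A \<and> a @ [r] \<in> words N A (Suc k)}"

end

theory Submission
  imports Defs
begin

text \<open>
  Prepending a letter \<open>i\<close> acts on the unit interval as the similarity \<open>t \<mapsto> (i + t) / N\<close>, so the
  Hausdorff measure of dimension \<open>\<delta>\<close> of \<open>\<sigma>\<^sub>i E\<close> is \<open>N\<^sup>-\<^sup>\<delta>\<close> times that of \<open>E\<close>
  (\<open>emeasure_prepend\<close>). Nothing else about Hausdorff measures is needed, except that a point has
  measure at most 1. In particular it does not matter whether \<open>mu\<close> is the Hausdorff measure or,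
  for lack of additivity, the zero measure. The matrix \<open>A\<close> is not assumed irreducible, so the
  measure might be infinite a priori; the existence of the mother wavelets excludes this
  (\<open>Rset_finite_measure\<close>).

  For a finite measure the scaling makes \<open>\<Phi>\<^sub>\<sigma>\<^sub>i\<close> almost everywhere equal to \<open>N\<^sup>-\<^sup>\<delta>\<close>. With
  \<open>\<kappa> = N\<^sup>\<delta>\<^sup>/\<^sup>2\<close> this gives \<open>S\<^sub>i f = \<kappa> \<chi>\<^sub>R\<^sub>i (f \<circ> \<sigma>)\<close>, with adjoint
  \<open>S\<^sub>i\<^sup>* g = \<kappa>\<^sup>-\<^sup>1 \<chi>\<^sub>D\<^sub>i (g \<circ> \<sigma>\<^sub>i)\<close>. The operator \<open>S\<^sub>i\<close> is a contraction, isometric on functions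
  supported in \<open>D\<^sub>i\<close>, and \<open>\<Sum>\<^sub>i S\<^sub>i S\<^sub>i\<^sup>* = 1\<close>. It maps \<open>\<SS>\<^sub>k\<close> into \<open>\<SS>\<^sub>k\<^sub>+\<^sub>1\<close>, and for \<open>k \<ge> 1\<close> the
  adjoint maps \<open>\<SS>\<^sub>k\<^sub>+\<^sub>1\<close> into \<open>\<SS>\<^sub>k\<close>. By adjunction both respect orthogonality, so \<open>S\<^sub>i\<close> and \<open>S\<^sub>i\<^sup>*\<close>
  move between the consecutive wavelet spaces \<open>\<SS>\<^sub>k\<^sub>+\<^sub>2 \<ominus> \<SS>\<^sub>k\<^sub>+\<^sub>1\<close> (\<open>Sop_Wspace\<close>, \<open>Tadj_Wspace\<close>).
  Writing \<open>g = \<Sum>\<^sub>i S\<^sub>i (S\<^sub>i\<^sup>* g)\<close>, induction on \<open>k\<close> shows that the functions \<open>S\<^sub>a f\<^sup>l\<^sup>,\<^sup>r\<close> span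
  (\<open>wav_span_level\<close>). They are orthonormal because those with different \<open>(a, r)\<close> live on disjoint
  cylinders, and for equal \<open>(a, r)\<close> the operator \<open>S\<^sub>a\<close> preserves the inner product.

  Wavelets of different levels are orthogonal since the spaces \<open>\<SS>\<^sub>k\<close> increase. The union of the
  \<open>\<SS>\<^sub>k\<close> is dense because the cylinders generate the sigma-algebra (\<open>Proj_tendsto\<close>), so the
  wavelets of all levels span the complement of \<open>\<SS>\<^sub>1\<close>.
\<close>

section \<open>Hausdorff measure under similarities\<close>

lemma diameter_similarity_le:
  fixes U :: "'a::metric_space set" and \<phi> :: "'a \<Rightarrow> 'b::metric_space"
  assumes "\<rho> > 0" and "\<And>x y. dist (\<phi> x) (\<phi> y) = \<rho> * dist x y" and "bounded U"
  shows "bounded (\<phi> ` U)" and "diameter (\<phi> ` U) \<le> \<rho> * diameter U"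
proof -
  obtain y e where "\<forall>x\<in>U. dist y x \<le> e"
    using assms(3) unfolding bounded_def by blast
  then have "\<forall>x\<in>U. dist (\<phi> y) (\<phi> x) \<le> \<rho> * e"
    using assms(1) by (simp add: assms(2))
  then show "bounded (\<phi> ` U)"
    unfolding bounded_def by blast
  show "diameter (\<phi> ` U) \<le> \<rho> * diameter U"
  proof (cases "U = {}")
    case False
    have "dist x y \<le> \<rho> * diameter U" if "x \<in> \<phi> ` U" "y \<in> \<phi> ` U" for x y
      using that assms diameter_bounded_bound[OF assms(3)] by auto
    then show ?thesis
      using False unfolding diameter_def by (auto intro!: cSUP_least)
  qed simp
qed

lemma diameter_similarity:
  fixes U :: "'a::metric_space set" and \<phi> :: "'a \<Rightarrow> 'b::metric_space"
  assumes "\<rho> > 0" and "\<And>x y. dist (\<phi> x) (\<phi> y) = \<rho> * dist x y" and "bounded U"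
  shows "diameter (\<phi> ` U) = \<rho> * diameter U"
proof (cases "U = {}")
  case False
  have b: "bounded (\<phi> ` U)"
    using diameter_similarity_le(1)[OF assms] .
  have "dist x y \<le> diameter (\<phi> ` U) / \<rho>" if "x \<in> U" "y \<in> U" for x y
    using diameter_bounded_bound[OF b, of "\<phi> x" "\<phi> y"] that assms(1,2) by (auto simp: field_simps)
  then have "diameter U \<le> diameter (\<phi> ` U) / \<rho>"
    using False unfolding diameter_def[of U] by (auto intro!: cSUP_least)
  then have "\<rho> * diameter U \<le> diameter (\<phi> ` U)"
    using assms(1) by (auto simp: field_simps)
  then show ?thesis
    using diameter_similarity_le(2)[OF assms] by simp
qed simp

lemma hausdorff_gauge_similarity:
  fixes U :: "'a::metric_space set" and \<phi> :: "'a \<Rightarrow> 'b::metric_space"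
  assumes "\<rho> > 0" and "\<And>x y. dist (\<phi> x) (\<phi> y) = \<rho> * dist x y" and "bounded U"
  shows "hausdorff_gauge s (\<phi> ` U) = ennreal (\<rho> powr s) * hausdorff_gauge s U"
  using diameter_similarity[OF assms] assms(1) diameter_ge_0[OF assms(3)]
  by (auto simp: hausdorff_gauge_def powr_mult ennreal_mult')

lemma hausdorff_outer_measure_similarity_le:
  fixes E :: "'a::metric_space set" and \<phi> :: "'a \<Rightarrow> 'b::metric_space"
  assumes \<rho>: "\<rho> > 0" and \<phi>: "\<And>x y. dist (\<phi> x) (\<phi> y) = \<rho> * dist x y"
  shows "hausdorff_outer_measure s (\<phi> ` E) \<le> ennreal (\<rho> powr s) * hausdorff_outer_measure s E"
  unfolding hausdorff_outer_measure_def
proof (rule SUP_least)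
  fix \<epsilon> :: real assume "\<epsilon> \<in> {0<..}"
  then have \<epsilon>: "\<epsilon> / \<rho> > 0" using \<rho> by simp
  have inv: "ennreal (\<rho> powr s) * (ennreal (\<rho> powr (-s)) * x) = x" for x
    using \<rho> by (simp add: mult.assoc[symmetric] ennreal_mult'[symmetric] powr_add[symmetric])
  have inv': "ennreal (\<rho> powr (-s)) * (ennreal (\<rho> powr s) * x) = x" for x
    using \<rho> by (simp add: mult.assoc[symmetric] ennreal_mult'[symmetric] powr_add[symmetric])
  have "ennreal (\<rho> powr (-s)) * hausdorff_premeasure s \<epsilon> (\<phi> ` E) \<le> hausdorff_premeasure s (\<epsilon> / \<rho>) E"
    unfolding hausdorff_premeasure_def[of s "\<epsilon> / \<rho>"]
  proof (rule INF_greatest)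
    fix U :: "nat \<Rightarrow> 'a set"
    assume "U \<in> {U. E \<subseteq> (\<Union>n. U n) \<and> (\<forall>n. bounded (U n) \<and> diameter (U n) \<le> \<epsilon> / \<rho>)}"
    then have U: "E \<subseteq> (\<Union>n. U n)" "\<And>n. bounded (U n)" "\<And>n. diameter (U n) \<le> \<epsilon> / \<rho>" by auto
    have "diameter (\<phi> ` U n) \<le> \<epsilon>" for n
      using diameter_similarity[OF \<rho> \<phi> U(2), of n] U(3)[of n] \<rho> by (simp add: field_simps)
    moreover have "\<phi> ` E \<subseteq> (\<Union>n. \<phi> ` U n)" using U(1) by blast
    ultimately have "(\<lambda>n. \<phi> ` U n) \<in> {U. \<phi> ` E \<subseteq> (\<Union>n. U n) \<and> (\<forall>n. bounded (U n) \<and> diameter (U n) \<le> \<epsilon>)}"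
      using diameter_similarity_le(1)[OF \<rho> \<phi> U(2)] by auto
    then have "hausdorff_premeasure s \<epsilon> (\<phi> ` E) \<le> (\<Sum>n. hausdorff_gauge s (\<phi> ` U n))"
      unfolding hausdorff_premeasure_def by (rule INF_lower)
    also have "\<dots> = ennreal (\<rho> powr s) * (\<Sum>n. hausdorff_gauge s (U n))"
      by (simp add: hausdorff_gauge_similarity[OF \<rho> \<phi> U(2)])
    finally have "ennreal (\<rho> powr (-s)) * hausdorff_premeasure s \<epsilon> (\<phi> ` E)
        \<le> ennreal (\<rho> powr (-s)) * (ennreal (\<rho> powr s) * (\<Sum>n. hausdorff_gauge s (U n)))"
      by (rule mult_left_mono) simp
    then show "ennreal (\<rho> powr (-s)) * hausdorff_premeasure s \<epsilon> (\<phi> ` E) \<le> (\<Sum>n. hausdorff_gauge s (U n))"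
      unfolding inv' .
  qed
  also have "\<dots> \<le> (SUP \<epsilon>\<in>{0<..}. hausdorff_premeasure s \<epsilon> E)"
    using \<epsilon> by (intro SUP_upper) simp
  finally have "ennreal (\<rho> powr s) * (ennreal (\<rho> powr (-s)) * hausdorff_premeasure s \<epsilon> (\<phi> ` E))
      \<le> ennreal (\<rho> powr s) * (SUP \<epsilon>\<in>{0<..}. hausdorff_premeasure s \<epsilon> E)"
    by (rule mult_left_mono) simp
  then show "hausdorff_premeasure s \<epsilon> (\<phi> ` E) \<le> ennreal (\<rho> powr s) * (SUP \<epsilon>\<in>{0<..}. hausdorff_premeasure s \<epsilon> E)"
    unfolding inv .
qed

text \<open>No sign condition on \<open>s\<close> is imposed, as \<open>delta\<close> is not known to be nonnegative here.\<close>
lemma hausdorff_outer_measure_similarity: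
  fixes E :: "'a::metric_space set" and \<phi> :: "'a \<Rightarrow> 'b::metric_space"
  assumes \<rho>: "\<rho> > 0" and \<phi>: "\<And>x y. dist (\<phi> x) (\<phi> y) = \<rho> * dist x y" and "surj \<phi>"
  shows "hausdorff_outer_measure s (\<phi> ` E) = ennreal (\<rho> powr s) * hausdorff_outer_measure s E"
proof (rule antisym)
  define \<theta> where "\<theta> = inv \<phi>"
  have "inj \<phi>" by (rule injI) (metis \<phi> \<rho> dist_eq_0_iff mult_eq_0_iff order_less_irrefl)
  then have \<theta>\<phi>: "\<theta> ` \<phi> ` E = E" unfolding \<theta>_def by (simp add: image_comp)
  have \<phi>\<theta>: "\<phi> (\<theta> y) = y" for y unfolding \<theta>_def using assms(3) by (rule surj_f_inv_f)
  have \<theta>: "dist (\<theta> x) (\<theta> y) = (1 / \<rho>) * dist x y" for x y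
    using \<phi>[of "\<theta> x" "\<theta> y"] \<rho> by (simp add: \<phi>\<theta>)
  have "hausdorff_outer_measure s E \<le> ennreal ((1 / \<rho>) powr s) * hausdorff_outer_measure s (\<phi> ` E)"
    using hausdorff_outer_measure_similarity_le[where \<phi> = \<theta> and \<rho> = "1/\<rho>" and E = "\<phi> ` E" and s = s] \<rho> \<theta>
    by (simp add: \<theta>\<phi>)
  then have "ennreal (\<rho> powr s) * hausdorff_outer_measure s E
      \<le> ennreal (\<rho> powr s) * (ennreal ((1 / \<rho>) powr s) * hausdorff_outer_measure s (\<phi> ` E))"
    by (rule mult_left_mono) simp
  also have "\<dots> = hausdorff_outer_measure s (\<phi> ` E)"
    using \<rho> by (simp add: mult.assoc[symmetric] ennreal_mult'[symmetric] powr_mult[symmetric])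
  finally show "ennreal (\<rho> powr s) * hausdorff_outer_measure s E \<le> hausdorff_outer_measure s (\<phi> ` E)" .
qed (rule hausdorff_outer_measure_similarity_le[OF \<rho> \<phi>])

lemma hausdorff_outer_measure_subsingleton:
  assumes "E \<subseteq> {p :: 'a::metric_space}"
  shows "hausdorff_outer_measure s E \<le> 1"
  unfolding hausdorff_outer_measure_def
proof (rule SUP_least)
  fix \<epsilon> :: real assume "\<epsilon> \<in> {0<..}"
  define U where "U n = (if n = 0 then {p} else {})" for n :: nat
  have "U \<in> {U. E \<subseteq> (\<Union>n. U n) \<and> (\<forall>n. bounded (U n) \<and> diameter (U n) \<le> \<epsilon>)}"
    using assms \<open>\<epsilon> \<in> {0<..}\<close> by (auto simp: U_def)
  then have "hausdorff_premeasure s \<epsilon> E \<le> (\<Sum>n. hausdorff_gauge s (U n))"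
    unfolding hausdorff_premeasure_def by (rule INF_lower)
  also have "\<dots> = (\<Sum>n\<in>{0}. hausdorff_gauge s (U n))"
    by (rule suminf_finite) (auto simp: U_def hausdorff_gauge_def)
  also have "\<dots> \<le> 1"
    by (simp add: U_def hausdorff_gauge_def)
  finally show "hausdorff_premeasure s \<epsilon> E \<le> 1" .
qed

section \<open>The sequence space, the shift and the scaling of the measure\<close>

text \<open>A nonempty alphabet with an arbitrary matrix.\<close>
locale admissible =
  fixes N :: nat and A :: "nat \<Rightarrow> nat \<Rightarrow> nat"
  assumes N_pos: "N > 0"
begin

abbreviation M :: "(nat \<Rightarrow> nat) measure" where "M \<equiv> mu N A"

text \<open>
  The factor \<open>N\<^sup>-\<^sup>\<delta>\<close> by which the maps \<open>\<sigma>\<^sub>i\<close> scale the measure; it is almost everywhere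
  the value of \<open>\<Phi>\<^sub>\<sigma>\<^sub>i\<close>.
\<close>
definition ratio :: real where "ratio = real N powr (- delta N A)"

lemma ratio_pos: "ratio > 0"
  using N_pos by (simp add: ratio_def)

lemma cylinder_subset_Lam: "cylinder N A a \<subseteq> Lam N A"
  by (auto simp: cylinder_def)

lemma cylinder_Nil: "cylinder N A [] = Lam N A"
  by (auto simp: cylinder_def)

lemma space_M [simp]: "space M = Lam N A"
  unfolding mu_def using cylinder_subset_Lam by (intro space_measure_of) auto

lemma sets_M: "sets M = sigma_sets (Lam N A) (range (cylinder N A))"
  unfolding mu_def using cylinder_subset_Lam by (intro sets_measure_of) auto

lemma cylinder_sets [measurable, simp]: "cylinder N A a \<in> sets M"
  unfolding sets_M by auto

lemma sets_M_subset: "E \<in> sets M \<Longrightarrow> E \<subseteq> Lam N A"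
  using sets.sets_into_space[of E M] by simp

lemma emeasure_M_conv:
  "emeasure M E = (if E \<in> sets M \<and> measure_space (Lam N A) (sets M)
       (\<lambda>E. hausdorff_outer_measure (delta N A) (adic N ` E))
     then hausdorff_outer_measure (delta N A) (adic N ` E) else 0)"
  unfolding sets_M unfolding mu_def emeasure_measure_of_conv ..

lemma emeasure_le_hausdorff:
  "emeasure M E \<le> hausdorff_outer_measure (delta N A) (adic N ` E)"
  by (simp add: emeasure_M_conv)

lemma Lam_step: "x \<in> Lam N A \<Longrightarrow> x n < N" "x \<in> Lam N A \<Longrightarrow> A (x n) (x (Suc n)) = 1"
  by (auto simp: Lam_def)

lemma shift_Lam: "x \<in> Lam N A \<Longrightarrow> shift x \<in> Lam N A"
  by (auto simp: Lam_def shift_def)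

lemma shift_prepend [simp]: "shift (prepend i x) = x"
  by (auto simp: shift_def prepend_def)

lemma prepend_shift: "prepend (x 0) (shift x) = x"
  by (rule ext) (auto simp: shift_def prepend_def split: nat.split)

lemma prepend_0 [simp]: "prepend i x 0 = i"
  and prepend_Suc [simp]: "prepend i x (Suc n) = x n"
  by (auto simp: prepend_def)

lemma in_Rset: "x \<in> Rset N A i \<longleftrightarrow> x \<in> Lam N A \<and> x 0 = i"
  by (auto simp: cylinder_def)

lemma in_Dset: "x \<in> Dset N A i \<longleftrightarrow> x \<in> Lam N A \<and> A i (x 0) = 1"
  by (auto simp: Dset_def)

lemma prepend_Rset: "i < N \<Longrightarrow> x \<in> Dset N A i \<Longrightarrow> prepend i x \<in> Rset N A i"
  unfolding in_Rset in_Dset Lam_def by (auto simp: prepend_def split: nat.split)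

lemma shift_Dset: "x \<in> Rset N A i \<Longrightarrow> shift x \<in> Dset N A i"
  unfolding in_Rset in_Dset Lam_def by (auto simp: shift_def)

lemma in_cylinder_Cons: 
  "x \<in> cylinder N A (i # b) \<longleftrightarrow> x \<in> Lam N A \<and> x 0 = i \<and> shift x \<in> cylinder N A b"
  using shift_Lam[of x] by (auto simp: cylinder_def shift_def less_Suc_eq_0_disj)

lemma in_cylinder_prepend:
  "i < N \<Longrightarrow> x \<in> Dset N A i \<Longrightarrow> prepend i x \<in> cylinder N A (i # b) \<longleftrightarrow> x \<in> cylinder N A b"
  using prepend_Rset[of i x] by (simp add: in_cylinder_Cons)

lemma shift_measurable [measurable]: "shift \<in> measurable M M"
proof (rule measurable_sigma_sets[OF sets_M])
  show "range (cylinder N A) \<subseteq> Pow (Lam N A)" using cylinder_subset_Lam by auto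
  show "shift \<in> space M \<rightarrow> Lam N A" using shift_Lam by auto
  fix E assume "E \<in> range (cylinder N A)"
  then obtain b where E: "E = cylinder N A b" by auto
  have "shift -` E \<inter> space M = (\<Union>i<N. cylinder N A (i # b))"
    using Lam_step(1) cylinder_subset_Lam by (fastforce simp: E in_cylinder_Cons)
  then show "shift -` E \<inter> space M \<in> sets M" by simp
qed

lemma Dset_conv: "Dset N A i = (\<Union>j\<in>{j. j < N \<and> A i j = 1}. Rset N A j)"
  using Lam_step(1) by (auto simp: in_Rset in_Dset)

lemma Dset_sets [measurable, simp]: "Dset N A i \<in> sets M"
  unfolding Dset_conv by (intro sets.finite_UN) auto

lemma prepend_image:
  assumes "i < N" "E \<subseteq> Dset N A i"
  shows "prepend i ` E = Rset N A i \<inter> (shift -` E \<inter> space M)"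
proof (rule set_eqI, rule iffI)
  fix x assume "x \<in> prepend i ` E"
  then obtain y where "x = prepend i y" "y \<in> E" by blast
  then show "x \<in> Rset N A i \<inter> (shift -` E \<inter> space M)"
    using prepend_Rset[OF assms(1), of y] assms(2) cylinder_subset_Lam by auto
next
  fix x assume "x \<in> Rset N A i \<inter> (shift -` E \<inter> space M)"
  then have "x = prepend i (shift x)" "shift x \<in> E"
    using prepend_shift[of x] by (auto simp: in_Rset)
  then show "x \<in> prepend i ` E" by blast
qed

lemma prepend_image_sets:
  assumes "i < N" "E \<in> sets M" "E \<subseteq> Dset N A i"
  shows "prepend i ` E \<in> sets M"
  unfolding prepend_image[OF assms(1,3)] using assms(2) by measurable

lemma adic_summable: 
  assumes "x \<in> Lam N A"
  shows "summable (\<lambda>n. real (x n) / real N ^ Suc n)"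
proof (cases "N = 1")
  case True
  then have "x n = 0" for n using Lam_step(1)[OF assms, of n] by simp
  then show ?thesis by simp
next
  case False
  then have N: "N \<ge> 2" using N_pos by simp
  have geo: "summable (\<lambda>n. (1 / real N) ^ n)"
    using N by (intro summable_geometric) simp
  have bound: "norm (real (x n) / real N ^ Suc n) \<le> (1 / real N) ^ n" for n
  proof -
    have "real (x n) / real N \<le> 1"
      using Lam_step(1)[OF assms, of n] by simp
    from mult_right_mono[OF this, of "(1 / real N) ^ n"] show ?thesis
      by (simp add: divide_inverse power_inverse mult.assoc)
  qed
  show ?thesis
    using bound by (rule summable_comparison_test'[OF geo])
qed

lemma adic_prepend:
  assumes "x \<in> Lam N A"
  shows "adic N (prepend i x) = (real i + adic N x) / real N"
proof -
  have "(\<lambda>n. real (x n) / real N ^ Suc n) sums adic N x"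
    unfolding adic_def using adic_summable[OF assms] by (rule summable_sums)
  from sums_divide[OF this, of "real N"]
  have "(\<lambda>n. real (prepend i x (Suc n)) / real N ^ Suc (Suc n)) sums (adic N x / real N)"
    by (simp add: divide_divide_eq_left mult_ac)
  then have "(\<lambda>n. real (prepend i x n) / real N ^ Suc n) sums (adic N x / real N + real i / real N)"
    by (subst (asm) sums_Suc_iff) simp
  then show ?thesis
    unfolding adic_def[of N "prepend i x"] by (simp add: sums_iff add_divide_distrib)
qed

text \<open>
  Prepending a letter is a similarity of ratio \<open>1/N\<close> on the unit interval. The identity also
  holds when the Hausdorff measure is not additive on the cylinder algebra, since \<open>mu\<close> is then
  the zero measure.
\<close>
lemma emeasure_prepend:
  assumes "i < N" "E \<in> sets M" "E \<subseteq> Dset N A i"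
  shows "emeasure M (prepend i ` E) = ennreal ratio * emeasure M E"
proof -
  define \<phi> where "\<phi> t = (real i + t) / real N" for t :: real
  have E: "E \<subseteq> Lam N A" using sets_M_subset[OF assms(2)] .
  have "adic N ` prepend i ` E = \<phi> ` adic N ` E"
    using E adic_prepend unfolding image_image \<phi>_def by (intro image_cong) auto
  moreover have "hausdorff_outer_measure (delta N A) (\<phi> ` adic N ` E)
     = ennreal ((1 / real N) powr delta N A) * hausdorff_outer_measure (delta N A) (adic N ` E)"
  proof (rule hausdorff_outer_measure_similarity)
    show "dist (\<phi> s) (\<phi> t) = (1 / real N) * dist s t" for s t
      using N_pos by (simp add: \<phi>_def dist_real_def diff_divide_distrib[symmetric])
    have "\<phi> (real N * t - real i) = t" for t
      using N_pos by (simp add: \<phi>_def)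
    then show "surj \<phi>" by (rule surjI)
  qed (use N_pos in simp)
  moreover have "(1 / real N) powr delta N A = ratio"
    by (simp add: ratio_def powr_minus_divide powr_divide)
  ultimately show ?thesis
    using prepend_image_sets[OF assms] assms(2) by (simp add: emeasure_M_conv)
qed

end

section \<open>Square integrable functions and closed linear spans\<close>

lemma L2_measurable [measurable_dest]: "f \<in> L2 M \<Longrightarrow> f \<in> borel_measurable M"
  by (simp add: L2_def)

lemma L2_sq_integrable: "f \<in> L2 M \<Longrightarrow> integrable M (\<lambda>x. (cmod (f x))\<^sup>2)"
  by (simp add: L2_def)

lemma L2_I:
  "f \<in> borel_measurable M \<Longrightarrow> integrable M (\<lambda>x. (cmod (f x))\<^sup>2) \<Longrightarrow> f \<in> L2 M"
  by (simp add: L2_def)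

lemma L2_dominated:
  assumes "g \<in> L2 M" and "f \<in> borel_measurable M" and "AE x in M. cmod (f x) \<le> C * cmod (g x)"
  shows "f \<in> L2 M"
proof (rule L2_I[OF assms(2)])
  note [measurable] = assms(2)
  show "integrable M (\<lambda>x. (cmod (f x))\<^sup>2)"
  proof (rule Bochner_Integration.integrable_bound)
    show "integrable M (\<lambda>x. C\<^sup>2 * (cmod (g x))\<^sup>2)"
      using L2_sq_integrable[OF assms(1)] by simp
    show "AE x in M. norm ((cmod (f x))\<^sup>2) \<le> norm (C\<^sup>2 * (cmod (g x))\<^sup>2)"
      using assms(3)
    proof eventually_elim
      case (elim x)
      then have "(cmod (f x))\<^sup>2 \<le> (C * cmod (g x))\<^sup>2"
        by (intro power_mono) auto
      then show ?case by (simp add: power_mult_distrib)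
    qed
  qed measurable
qed

lemma cmod_add_sq_le: "(cmod (a + b))\<^sup>2 \<le> 2 * (cmod a)\<^sup>2 + 2 * (cmod b)\<^sup>2"
proof -
  have "(cmod (a + b))\<^sup>2 \<le> (cmod a + cmod b)\<^sup>2"
    by (intro power_mono norm_triangle_ineq) simp
  also have "\<dots> \<le> 2 * (cmod a)\<^sup>2 + 2 * (cmod b)\<^sup>2"
    using sum_squares_bound[of "cmod a" "cmod b"] by (simp add: power2_sum)
  finally show ?thesis .
qed

lemma L2_add:
  assumes "f \<in> L2 M" "g \<in> L2 M"
  shows "(\<lambda>x. f x + g x) \<in> L2 M"
proof (rule L2_I)
  note [measurable] = assms[THEN L2_measurable]
  show "integrable M (\<lambda>x. (cmod (f x + g x))\<^sup>2)"
    by (rule Bochner_Integration.integrable_bound[where f = "\<lambda>x. 2 * (cmod (f x))\<^sup>2 + 2 * (cmod (g x))\<^sup>2"])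
      (use assms cmod_add_sq_le in \<open>auto simp: L2_sq_integrable intro!: AE_I2\<close>)
qed (use assms in measurable)

lemma L2_scale: "f \<in> L2 M \<Longrightarrow> (\<lambda>x. a * f x) \<in> L2 M"
  by (rule L2_dominated[where g = f and C = "cmod a"]) (auto simp: norm_mult L2_measurable)

lemma L2_diff: "f \<in> L2 M \<Longrightarrow> g \<in> L2 M \<Longrightarrow> (\<lambda>x. f x - g x) \<in> L2 M"
  using L2_add[of f M "\<lambda>x. - 1 * g x"] L2_scale[of g M "- 1"] by simp

lemma L2_zero: "(\<lambda>x. 0) \<in> L2 M"
  by (simp add: L2_def)

lemma L2_sum: "(\<And>i. i \<in> F \<Longrightarrow> f i \<in> L2 M) \<Longrightarrow> (\<lambda>x. \<Sum>i\<in>F. f i x) \<in> L2 M"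
  by (induction F rule: infinite_finite_induct) (auto intro: L2_add L2_zero)

lemma borel_measurable_cnj [measurable (raw)]:
  "f \<in> borel_measurable M \<Longrightarrow> (\<lambda>x. cnj (f x)) \<in> borel_measurable M"
  by (rule borel_measurable_continuous_on[of cnj]) (intro continuous_intros)

lemma L2_inner_integrable:
  assumes "f \<in> L2 M" "g \<in> L2 M"
  shows "integrable M (\<lambda>x. cnj (f x) * g x)"
proof (rule Bochner_Integration.integrable_bound)
  note [measurable] = assms[THEN L2_measurable]
  show "integrable M (\<lambda>x. (cmod (f x))\<^sup>2 + (cmod (g x))\<^sup>2)"
    using assms by (simp add: L2_sq_integrable)
  have "cmod a * cmod b \<le> (cmod a)\<^sup>2 + (cmod b)\<^sup>2" for a b
    using sum_squares_bound[of "cmod a" "cmod b"] mult_nonneg_nonneg[OF norm_ge_zero norm_ge_zero, of a b]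
    by linarith
  then show "AE x in M. norm (cnj (f x) * g x) \<le> norm ((cmod (f x))\<^sup>2 + (cmod (g x))\<^sup>2)"
    by (intro AE_I2) (simp add: norm_mult)
qed (use assms[THEN L2_measurable] in measurable)

lemma l2_inner_cong_AE:
  assumes "AE x in M. cnj (f x) * g x = cnj (f' x) * g' x"
    and "f \<in> borel_measurable M" "f' \<in> borel_measurable M"
    and "g \<in> borel_measurable M" "g' \<in> borel_measurable M"
  shows "l2_inner M f g = l2_inner M f' g'"
  unfolding l2_inner_def by (rule integral_cong_AE) (use assms in measurable)

lemma l2_norm_cong_AE:
  assumes "AE x in M. f x = f' x" and "f \<in> borel_measurable M" "f' \<in> borel_measurable M"
  shows "l2_norm M f = l2_norm M f'"
proof -
  have "(\<integral>x. (cmod (f x))\<^sup>2 \<partial>M) = (\<integral>x. (cmod (f' x))\<^sup>2 \<partial>M)"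
    by (rule integral_cong_AE) (use assms in \<open>measurable, auto elim!: eventually_mono\<close>)
  then show ?thesis by (simp add: l2_norm_def)
qed

lemma l2_inner_diff_right:
  assumes "f \<in> L2 M" "g \<in> L2 M" "h \<in> L2 M"
  shows "l2_inner M f (\<lambda>x. g x - h x) = l2_inner M f g - l2_inner M f h"
  unfolding l2_inner_def using assms by (simp add: right_diff_distrib L2_inner_integrable)

lemma l2_inner_cnj: "l2_inner M g f = cnj (l2_inner M f g)"
proof -
  have "cnj (l2_inner M f g) = (\<integral>x. cnj (cnj (f x) * g x) \<partial>M)"
    unfolding l2_inner_def by (simp del: complex_cnj_mult)
  then show ?thesis
    by (simp add: l2_inner_def mult.commute)
qed

lemma l2_inner_sum_left:
  assumes "\<And>i. i \<in> F \<Longrightarrow> f i \<in> L2 M" and "g \<in> L2 M"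
  shows "l2_inner M (\<lambda>x. \<Sum>i\<in>F. c i * f i x) g = (\<Sum>i\<in>F. cnj (c i) * l2_inner M (f i) g)"
proof -
  have "l2_inner M (\<lambda>x. \<Sum>i\<in>F. c i * f i x) g = (\<integral>x. (\<Sum>i\<in>F. cnj (c i) * (cnj (f i x) * g x)) \<partial>M)"
    unfolding l2_inner_def by (simp add: sum_distrib_left sum_distrib_right mult_ac)
  also have "\<dots> = (\<Sum>i\<in>F. (\<integral>x. cnj (c i) * (cnj (f i x) * g x) \<partial>M))"
    using assms by (intro Bochner_Integration.integral_sum integrable_mult_right L2_inner_integrable) auto
  finally show ?thesis
    by (simp add: l2_inner_def)
qed

lemma l2_norm_sq: "(l2_norm M f)\<^sup>2 = (\<integral>x. (cmod (f x))\<^sup>2 \<partial>M)"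
  unfolding l2_norm_def by (rule real_sqrt_pow2) (simp add: integral_nonneg_AE)

lemma l2_norm_sq_eq_inner: "complex_of_real ((l2_norm M f)\<^sup>2) = l2_inner M f f"
proof -
  have "cnj (f x) * f x = complex_of_real ((cmod (f x))\<^sup>2)" for x
    by (simp only: complex_norm_square mult.commute)
  then show ?thesis unfolding l2_norm_sq l2_inner_def by (simp del: of_real_power)
qed

lemma l2_norm_nonneg: "l2_norm M f \<ge> 0"
  unfolding l2_norm_def by (rule real_sqrt_ge_zero) (simp add: integral_nonneg_AE)

lemma l2_norm_less_iff: "\<epsilon> > 0 \<Longrightarrow> l2_norm M f < \<epsilon> \<longleftrightarrow> (l2_norm M f)\<^sup>2 < \<epsilon>\<^sup>2"
  using l2_norm_nonneg[of M f] by (metis less_imp_le pos2 power2_less_imp_less power_strict_mono)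

lemma l2_norm_scale: "l2_norm M (\<lambda>x. a * f x) = cmod a * l2_norm M f"
  unfolding l2_norm_def by (simp add: norm_mult power_mult_distrib real_sqrt_mult)

lemma l2_norm_add_less:
  assumes "f \<in> L2 M" "g \<in> L2 M" "l2_norm M f < \<epsilon> / 2" "l2_norm M g < \<epsilon> / 2"
  shows "l2_norm M (\<lambda>x. f x + g x) < \<epsilon>"
proof -
  have \<epsilon>: "\<epsilon> > 0" using assms(3) l2_norm_nonneg[of M f] by linarith
  have "(l2_norm M (\<lambda>x. f x + g x))\<^sup>2 \<le> (\<integral>x. 2 * (cmod (f x))\<^sup>2 + 2 * (cmod (g x))\<^sup>2 \<partial>M)"
    unfolding l2_norm_sq
    by (rule integral_mono)
      (use assms L2_sq_integrable[OF L2_add[OF assms(1,2)]] in \<open>auto simp: L2_sq_integrable cmod_add_sq_le\<close>)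
  also have "\<dots> = 2 * (l2_norm M f)\<^sup>2 + 2 * (l2_norm M g)\<^sup>2"
    unfolding l2_norm_sq using assms by (simp add: L2_sq_integrable)
  also have "\<dots> < 2 * (\<epsilon> / 2)\<^sup>2 + 2 * (\<epsilon> / 2)\<^sup>2"
    using assms(3,4) l2_norm_nonneg[of M f] l2_norm_nonneg[of M g]
    by (intro add_strict_mono mult_strict_left_mono power_strict_mono) auto
  also have "\<dots> = \<epsilon>\<^sup>2" by (simp add: power2_eq_square)
  finally show ?thesis using \<epsilon> by (simp add: l2_norm_less_iff)
qed

lemma l2_norm_Pythagoras:
  assumes "f \<in> L2 M" "g \<in> L2 M" "l2_inner M g f = 0"
  shows "(l2_norm M (\<lambda>x. f x + g x))\<^sup>2 = (l2_norm M f)\<^sup>2 + (l2_norm M g)\<^sup>2"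
proof -
  have "(cmod (a + b))\<^sup>2 = (cmod a)\<^sup>2 + (cmod b)\<^sup>2 + 2 * Re (cnj b * a)" for a b
    by (simp add: cmod_power2 power2_sum algebra_simps)
  then have "(l2_norm M (\<lambda>x. f x + g x))\<^sup>2
      = (\<integral>x. (cmod (f x))\<^sup>2 + (cmod (g x))\<^sup>2 + 2 * Re (cnj (g x) * f x) \<partial>M)"
    unfolding l2_norm_sq by simp
  also have "\<dots> = (l2_norm M f)\<^sup>2 + (l2_norm M g)\<^sup>2 + 2 * (\<integral>x. Re (cnj (g x) * f x) \<partial>M)"
    unfolding l2_norm_sq using assms L2_inner_integrable[OF assms(2,1)]
    by (simp add: L2_sq_integrable del: Re_complex_of_real times_complex.simps)
  also have "(\<integral>x. Re (cnj (g x) * f x) \<partial>M) = 0"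
    using integral_Re[OF L2_inner_integrable[OF assms(2,1)]] assms(3)
    unfolding l2_inner_def by simp
  finally show ?thesis by simp
qed

text \<open>The closed linear span of a family: the last clause of the definition of a basis.\<close>
definition in_closed_span ::
    "'a measure \<Rightarrow> 'i set \<Rightarrow> ('i \<Rightarrow> 'a \<Rightarrow> complex) \<Rightarrow> ('a \<Rightarrow> complex) \<Rightarrow> bool" where
  "in_closed_span M I \<phi> g \<longleftrightarrow> (\<forall>\<epsilon>>0. \<exists>F c. finite F \<and> F \<subseteq> I \<and>
     l2_norm M (\<lambda>x. g x - (\<Sum>i\<in>F. c i * \<phi> i x)) < \<epsilon>)"

lemma orthonormal_basis_iff:
  "orthonormal_basis M I \<phi> V \<longleftrightarrow> (\<forall>i\<in>I. \<phi> i \<in> V) \<and>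
     (\<forall>i\<in>I. \<forall>j\<in>I. l2_inner M (\<phi> i) (\<phi> j) = (if i = j then 1 else 0)) \<and>
     (\<forall>g\<in>V. in_closed_span M I \<phi> g)"
  by (simp add: orthonormal_basis_def in_closed_span_def)

lemma closed_span_mono: "in_closed_span M I \<phi> g \<Longrightarrow> I \<subseteq> J \<Longrightarrow> in_closed_span M J \<phi> g"
  unfolding in_closed_span_def by (meson subset_trans)

lemma closed_span_base:
  assumes "i \<in> I"
  shows "in_closed_span M I \<phi> (\<phi> i)"
  unfolding in_closed_span_def
  by (intro allI impI exI[of _ "{i}"] exI[of _ "\<lambda>_. 1"]) (simp add: assms l2_norm_def)

lemma closed_span_null:
  assumes "AE x in M. g x = 0" "g \<in> borel_measurable M"
  shows "in_closed_span M I \<phi> g"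
proof -
  have "l2_norm M g = l2_norm M (\<lambda>x. 0)"
    using assms by (intro l2_norm_cong_AE) auto
  then have "l2_norm M (\<lambda>x. g x - (\<Sum>i\<in>{}. 0 * \<phi> i x)) = 0"
    by (simp add: l2_norm_def)
  then show ?thesis
    unfolding in_closed_span_def
    by (intro allI impI exI[of _ "{}"] exI[of _ "\<lambda>_. 0"]) simp
qed

lemma closed_span_limit:
  assumes \<phi>: "\<And>i. i \<in> I \<Longrightarrow> \<phi> i \<in> L2 M" and g: "g \<in> L2 M"
    and lim: "\<And>\<epsilon>. \<epsilon> > 0 \<Longrightarrow> \<exists>h\<in>L2 M. in_closed_span M I \<phi> h \<and> l2_norm M (\<lambda>x. g x - h x) < \<epsilon>"
  shows "in_closed_span M I \<phi> g"
  unfolding in_closed_span_def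
proof (intro allI impI)
  fix \<epsilon> :: real assume "\<epsilon> > 0"
  then have e2: "\<epsilon> / 2 > 0" by simp
  obtain h where h: "h \<in> L2 M" "in_closed_span M I \<phi> h" "l2_norm M (\<lambda>x. g x - h x) < \<epsilon> / 2"
    using lim[OF e2] by blast
  obtain F c where F: "finite F" "F \<subseteq> I" "l2_norm M (\<lambda>x. h x - (\<Sum>i\<in>F. c i * \<phi> i x)) < \<epsilon> / 2"
    using h(2) e2 unfolding in_closed_span_def by blast
  have "(\<lambda>x. \<Sum>i\<in>F. c i * \<phi> i x) \<in> L2 M"
    using F(2) \<phi> by (intro L2_sum L2_scale) auto
  then have "l2_norm M (\<lambda>x. (g x - h x) + (h x - (\<Sum>i\<in>F. c i * \<phi> i x))) < \<epsilon>"
    using F(3) h g by (intro l2_norm_add_less L2_diff) auto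
  then show "\<exists>F c. finite F \<and> F \<subseteq> I \<and> l2_norm M (\<lambda>x. g x - (\<Sum>i\<in>F. c i * \<phi> i x)) < \<epsilon>"
    using F(1,2) by (intro exI[of _ F] exI[of _ c]) simp
qed

lemma closed_span_cong_AE:
  assumes "in_closed_span M I \<phi> h" "\<And>i. i \<in> I \<Longrightarrow> \<phi> i \<in> L2 M" "g \<in> L2 M" "h \<in> L2 M"
    "AE x in M. g x = h x"
  shows "in_closed_span M I \<phi> g"
proof (rule closed_span_limit)
  have "l2_norm M (\<lambda>x. g x - h x) = l2_norm M (\<lambda>x. 0)"
    using assms(3-5) by (intro l2_norm_cong_AE) (auto simp: L2_measurable elim!: eventually_mono)
  then show "\<exists>h\<in>L2 M. in_closed_span M I \<phi> h \<and> l2_norm M (\<lambda>x. g x - h x) < \<epsilon>" if "\<epsilon> > 0" for \<epsilon>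
    using assms(1,4) that by (intro bexI[of _ h]) (auto simp: l2_norm_def)
qed (use assms in auto)

lemma closed_span_add:
  assumes \<phi>: "\<And>i. i \<in> I \<Longrightarrow> \<phi> i \<in> L2 M" and "g \<in> L2 M" "h \<in> L2 M"
    and "in_closed_span M I \<phi> g" "in_closed_span M I \<phi> h"
  shows "in_closed_span M I \<phi> (\<lambda>x. g x + h x)"
  unfolding in_closed_span_def
proof (intro allI impI)
  fix \<epsilon> :: real assume "\<epsilon> > 0"
  then have e2: "\<epsilon> / 2 > 0" by simp
  obtain F c where F: "finite F" "F \<subseteq> I" "l2_norm M (\<lambda>x. g x - (\<Sum>i\<in>F. c i * \<phi> i x)) < \<epsilon> / 2"
    using assms(4) e2 unfolding in_closed_span_def by blast
  obtain G d where G: "finite G" "G \<subseteq> I" "l2_norm M (\<lambda>x. h x - (\<Sum>i\<in>G. d i * \<phi> i x)) < \<epsilon> / 2"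
    using assms(5) e2 unfolding in_closed_span_def by blast
  define e where "e i = (if i \<in> F then c i else 0) + (if i \<in> G then d i else 0)" for i
  have "(\<Sum>i\<in>F \<union> G. e i * \<phi> i x) = (\<Sum>i\<in>F. c i * \<phi> i x) + (\<Sum>i\<in>G. d i * \<phi> i x)" for x
  proof -
    have "(\<Sum>i\<in>F \<union> G. (if i \<in> F then c i else 0) * \<phi> i x) = (\<Sum>i\<in>F. c i * \<phi> i x)"
      using F(1) G(1) by (intro sum.mono_neutral_cong_right) auto
    moreover have "(\<Sum>i\<in>F \<union> G. (if i \<in> G then d i else 0) * \<phi> i x) = (\<Sum>i\<in>G. d i * \<phi> i x)"
      using F(1) G(1) by (intro sum.mono_neutral_cong_right) auto
    ultimately show ?thesis
      unfolding e_def by (simp add: distrib_right sum.distrib)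
  qed
  moreover have "l2_norm M (\<lambda>x. (g x - (\<Sum>i\<in>F. c i * \<phi> i x)) + (h x - (\<Sum>i\<in>G. d i * \<phi> i x))) < \<epsilon>"
    using F(2,3) G(2,3) assms(2,3) by (intro l2_norm_add_less L2_diff L2_sum L2_scale) (auto intro: \<phi>)
  ultimately have "l2_norm M (\<lambda>x. (g x + h x) - (\<Sum>i\<in>F \<union> G. e i * \<phi> i x)) < \<epsilon>"
    by (simp add: algebra_simps)
  then show "\<exists>F c. finite F \<and> F \<subseteq> I \<and> l2_norm M (\<lambda>x. (g x + h x) - (\<Sum>i\<in>F. c i * \<phi> i x)) < \<epsilon>"
    using F(1,2) G(1,2) by (intro exI[of _ "F \<union> G"] exI[of _ e]) auto
qed

lemma closed_span_scale:
  assumes "in_closed_span M I \<phi> g"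
  shows "in_closed_span M I \<phi> (\<lambda>x. a * g x)"
  unfolding in_closed_span_def
proof (intro allI impI)
  fix \<epsilon> :: real assume "\<epsilon> > 0"
  then have "\<epsilon> / (cmod a + 1) > 0" by (simp add: add_nonneg_pos)
  then obtain F c where F: "finite F" "F \<subseteq> I"
      "l2_norm M (\<lambda>x. g x - (\<Sum>i\<in>F. c i * \<phi> i x)) < \<epsilon> / (cmod a + 1)"
    using assms unfolding in_closed_span_def by blast
  have "l2_norm M (\<lambda>x. a * g x - (\<Sum>i\<in>F. (a * c i) * \<phi> i x))
      = l2_norm M (\<lambda>x. a * (g x - (\<Sum>i\<in>F. c i * \<phi> i x)))"
    by (simp add: right_diff_distrib sum_distrib_left mult.assoc)
  also have "\<dots> \<le> (cmod a + 1) * l2_norm M (\<lambda>x. g x - (\<Sum>i\<in>F. c i * \<phi> i x))"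
    unfolding l2_norm_scale using l2_norm_nonneg by (intro mult_right_mono) auto
  also have "\<dots> < \<epsilon>"
    using F(3) by (simp add: pos_less_divide_eq add_nonneg_pos mult.commute)
  finally show "\<exists>F c. finite F \<and> F \<subseteq> I \<and> l2_norm M (\<lambda>x. a * g x - (\<Sum>i\<in>F. c i * \<phi> i x)) < \<epsilon>"
    using F(1,2) by (intro exI[of _ F] exI[of _ "\<lambda>i. a * c i"]) simp
qed

lemma closed_span_sum:
  assumes "\<And>i. i \<in> I \<Longrightarrow> \<phi> i \<in> L2 M"
    and "\<And>j. j \<in> F \<Longrightarrow> g j \<in> L2 M" "\<And>j. j \<in> F \<Longrightarrow> in_closed_span M I \<phi> (g j)"
  shows "in_closed_span M I \<phi> (\<lambda>x. \<Sum>j\<in>F. g j x)"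
  using assms(2,3)
proof (induction F rule: infinite_finite_induct)
  case (insert j F)
  then have "in_closed_span M I \<phi> (\<lambda>x. g j x + (\<Sum>j\<in>F. g j x))"
    by (intro closed_span_add assms(1) L2_sum) auto
  then show ?case using insert by simp
qed (auto intro: closed_span_null)

lemma closed_span_trans:
  assumes "in_closed_span M I \<phi> g" "g \<in> L2 M"
    and "\<And>i. i \<in> I \<Longrightarrow> \<phi> i \<in> L2 M" "\<And>j. j \<in> J \<Longrightarrow> \<phi>' j \<in> L2 M"
    and "\<And>i. i \<in> I \<Longrightarrow> in_closed_span M J \<phi>' (\<phi> i)"
  shows "in_closed_span M J \<phi>' g"
proof (rule closed_span_limit)
  fix \<epsilon> :: real assume "\<epsilon> > 0"
  then obtain F c where F: "finite F" "F \<subseteq> I" "l2_norm M (\<lambda>x. g x - (\<Sum>i\<in>F. c i * \<phi> i x)) < \<epsilon>"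
    using assms(1) unfolding in_closed_span_def by blast
  then have "in_closed_span M J \<phi>' (\<lambda>x. \<Sum>i\<in>F. c i * \<phi> i x)"
    using assms(3-5) by (intro closed_span_sum closed_span_scale L2_scale) auto
  moreover have "(\<lambda>x. \<Sum>i\<in>F. c i * \<phi> i x) \<in> L2 M"
    using F(2) assms(3) by (intro L2_sum L2_scale) auto
  ultimately show "\<exists>h\<in>L2 M. in_closed_span M J \<phi>' h \<and> l2_norm M (\<lambda>x. g x - h x) < \<epsilon>"
    using F(3) by blast
qed (use assms in auto)

text \<open>A form of the Cauchy--Schwarz inequality with a free weight instead of square roots.\<close>
lemma cmod_l2_inner_le:
  assumes "u \<in> L2 M" "v \<in> L2 M" "t > 0"
  shows "cmod (l2_inner M u v) \<le> t * (l2_norm M u)\<^sup>2 + (l2_norm M v)\<^sup>2 / t"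
proof -
  have "cmod a * cmod b \<le> t * (cmod a)\<^sup>2 + (cmod b)\<^sup>2 / t" for a b
  proof -
    have "0 \<le> (sqrt t * cmod a)\<^sup>2 + (cmod b / sqrt t)\<^sup>2 - 2 * (sqrt t * cmod a) * (cmod b / sqrt t)"
      using sum_squares_bound[of "sqrt t * cmod a" "cmod b / sqrt t"] by simp
    then have "2 * (cmod a * cmod b) \<le> t * (cmod a)\<^sup>2 + (cmod b)\<^sup>2 / t"
      using assms(3) by (simp add: power_mult_distrib power_divide)
    then show ?thesis
      using mult_nonneg_nonneg[OF norm_ge_zero norm_ge_zero, of a b] by linarith
  qed
  then have "cmod (cnj (u x) * v x) \<le> t * (cmod (u x))\<^sup>2 + (cmod (v x))\<^sup>2 / t" for x
    by (simp add: norm_mult)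
  then have "(\<integral>x. cmod (cnj (u x) * v x) \<partial>M) \<le> (\<integral>x. t * (cmod (u x))\<^sup>2 + (cmod (v x))\<^sup>2 / t \<partial>M)"
    using assms by (intro integral_mono integrable_norm L2_inner_integrable) (auto simp: L2_sq_integrable)
  also have "\<dots> = t * (l2_norm M u)\<^sup>2 + (l2_norm M v)\<^sup>2 / t"
    using assms by (simp add: l2_norm_sq L2_sq_integrable)
  finally show ?thesis
    unfolding l2_inner_def by (rule order_trans[OF integral_norm_bound])
qed

lemma closed_span_orthogonal:
  assumes h: "in_closed_span M I \<phi> h" "h \<in> L2 M" and \<phi>: "\<And>i. i \<in> I \<Longrightarrow> \<phi> i \<in> L2 M"
    and u: "u \<in> L2 M" and orth: "\<And>i. i \<in> I \<Longrightarrow> l2_inner M u (\<phi> i) = 0"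
  shows "l2_inner M u h = 0"
proof (rule ccontr)
  define z where "z = cmod (l2_inner M u h)"
  assume "l2_inner M u h \<noteq> 0"
  then have z: "z > 0" by (simp add: z_def)
  define U where "U = (l2_norm M u)\<^sup>2 + 1"
  have U: "U > 0" by (simp add: U_def add_nonneg_pos)
  \<comment> \<open>With this weight the term of \<open>u\<close> is at most half of \<open>z\<close>.\<close>
  define t where "t = z / (2 * U)"
  have t: "t > 0" using z U by (simp add: t_def)
  have "t * U = z / 2"
    using U by (simp add: t_def)
  then have tu: "t * (l2_norm M u)\<^sup>2 \<le> z / 2"
    using t unfolding U_def distrib_left by linarith
  have "sqrt (t * z / 2) > 0" using t z by simp
  then obtain F c where F: "finite F" "F \<subseteq> I"
      "l2_norm M (\<lambda>x. h x - (\<Sum>i\<in>F. c i * \<phi> i x)) < sqrt (t * z / 2)"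
    using h(1) unfolding in_closed_span_def by blast
  let ?w = "\<lambda>x. \<Sum>i\<in>F. c i * \<phi> i x"
  have w: "?w \<in> L2 M" using F(2) \<phi> by (intro L2_sum L2_scale) auto
  have "l2_inner M ?w u = (\<Sum>i\<in>F. cnj (c i) * l2_inner M (\<phi> i) u)"
    using F(2) \<phi> u by (intro l2_inner_sum_left) auto
  also have "\<dots> = 0"
    using F(2) orth l2_inner_cnj[of M _ u] by (intro sum.neutral) auto
  finally have "l2_inner M u (\<lambda>x. h x - ?w x) = l2_inner M u h"
    using l2_inner_diff_right[OF u h(2) w] l2_inner_cnj[of M u ?w] by simp
  then have "z \<le> t * (l2_norm M u)\<^sup>2 + (l2_norm M (\<lambda>x. h x - ?w x))\<^sup>2 / t"
    using cmod_l2_inner_le[OF u L2_diff[OF h(2) w] t] by (simp add: z_def)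
  moreover have "(l2_norm M (\<lambda>x. h x - ?w x))\<^sup>2 / t < z / 2"
  proof -
    have "(l2_norm M (\<lambda>x. h x - ?w x))\<^sup>2 < (sqrt (t * z / 2))\<^sup>2"
      using F(3) l2_norm_nonneg by (intro power_strict_mono) auto
    also have "\<dots> = t * z / 2" using t z by simp
    finally show ?thesis using t by (simp add: pos_divide_less_eq mult.commute)
  qed
  ultimately show False using tu by linarith
qed

lemma indicator_L2_finite:
  assumes "E \<in> sets M" "emeasure M E < \<infinity>"
  shows "(indicator E :: _ \<Rightarrow> complex) \<in> L2 M"
proof (rule L2_I)
  have "(\<lambda>x. (cmod (indicator E x))\<^sup>2) = (indicator E :: _ \<Rightarrow> real)"
    by (auto simp: fun_eq_iff split: split_indicator)
  moreover have "integrable M (indicator E :: _ \<Rightarrow> real)"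
    using assms by (intro integrable_real_indicator) auto
  ultimately show "integrable M (\<lambda>x. (cmod (indicator E x))\<^sup>2)" by simp
qed (use assms in simp)

lemma L2_const_on_infinite:
  assumes "f \<in> L2 M" "E \<in> sets M" "emeasure M E = \<infinity>" "AE x in M. x \<in> E \<longrightarrow> f x = c"
  shows "c = 0"
proof (rule ccontr)
  assume "c \<noteq> 0"
  have "integrable M (indicator E :: _ \<Rightarrow> real)"
  proof (rule Bochner_Integration.integrable_bound)
    show "integrable M (\<lambda>x. (1 / (cmod c)\<^sup>2) * (cmod (f x))\<^sup>2)"
      using L2_sq_integrable[OF assms(1)] by (rule integrable_mult_right)
    show "AE x in M. norm (indicator E x :: real) \<le> norm ((1 / (cmod c)\<^sup>2) * (cmod (f x))\<^sup>2)"
      using assms(4) by eventually_elim (use \<open>c \<noteq> 0\<close> in \<open>auto split: split_indicator\<close>)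
  qed (use assms(2) in measurable)
  then show False
    using assms(2,3) sets.sets_into_space[OF assms(2)] by (simp add: integrable_indicator_iff Int_absorb2)
qed

text \<open>
  The bound \<open>2 |g|\<close> is the one satisfied by the standard approximation of a measurable function
  by simple functions.
\<close>
lemma L2_truncation_limit:
  assumes g: "g \<in> L2 M" and s: "\<And>n. s n \<in> borel_measurable M"
    and lim: "\<And>x. x \<in> space M \<Longrightarrow> (\<lambda>n. s n x) \<longlonglongrightarrow> g x"
    and bound: "\<And>n x. x \<in> space M \<Longrightarrow> cmod (s n x) \<le> 2 * cmod (g x)"
    and "\<epsilon> > 0"
  shows "\<exists>n. l2_norm M (\<lambda>x. g x - s n x) < \<epsilon>"
proof -
  note [measurable] = L2_measurable[OF g] s
  have "(\<lambda>n. (\<integral>x. (cmod (g x - s n x))\<^sup>2 \<partial>M)) \<longlonglongrightarrow> (\<integral>x. 0 \<partial>M)"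
  proof (rule integral_dominated_convergence)
    show "integrable M (\<lambda>x. 9 * (cmod (g x))\<^sup>2)"
      using L2_sq_integrable[OF g] by simp
    show "AE x in M. (\<lambda>n. (cmod (g x - s n x))\<^sup>2) \<longlonglongrightarrow> 0"
    proof (rule AE_I2)
      fix x assume "x \<in> space M"
      have "(\<lambda>n. (cmod (g x - s n x))\<^sup>2) \<longlonglongrightarrow> (cmod (g x - g x))\<^sup>2"
        using lim[OF \<open>x \<in> space M\<close>] by (intro tendsto_intros)
      then show "(\<lambda>n. (cmod (g x - s n x))\<^sup>2) \<longlonglongrightarrow> 0" by simp
    qed
    fix n
    show "AE x in M. norm ((cmod (g x - s n x))\<^sup>2) \<le> 9 * (cmod (g x))\<^sup>2"
    proof (rule AE_I2)
      fix x assume "x \<in> space M"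
      then have "cmod (g x - s n x) \<le> 3 * cmod (g x)"
        using norm_triangle_ineq4[of "g x" "s n x"] bound[of x n] by linarith
      then have "(cmod (g x - s n x))\<^sup>2 \<le> (3 * cmod (g x))\<^sup>2"
        by (intro power_mono) auto
      then show "norm ((cmod (g x - s n x))\<^sup>2) \<le> 9 * (cmod (g x))\<^sup>2"
        by (simp add: power_mult_distrib)
    qed
  qed measurable
  then have "\<forall>\<^sub>F n in sequentially. (l2_norm M (\<lambda>x. g x - s n x))\<^sup>2 < \<epsilon>\<^sup>2"
    using \<open>\<epsilon> > 0\<close> by (intro order_tendstoD(2)[where y = 0]) (simp_all add: l2_norm_sq)
  then show ?thesis
    using \<open>\<epsilon> > 0\<close> by (auto simp: l2_norm_less_iff dest!: eventually_happens)
qed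

section \<open>Change of variables under the shift\<close>

context admissible
begin

lemma Dset_Int_Lam: "Dset N A i \<inter> Lam N A = Dset N A i"
  by (auto simp: in_Dset)

lemma emeasure_shift:
  assumes "i < N" "E \<in> sets M"
  shows "emeasure M (Rset N A i \<inter> (shift -` E \<inter> space M)) = ennreal ratio * emeasure M (E \<inter> Dset N A i)"
proof -
  have "Rset N A i \<inter> (shift -` E \<inter> space M) = prepend i ` (E \<inter> Dset N A i)"
    using assms(1) shift_Dset by (subst prepend_image) auto
  then show ?thesis
    using assms emeasure_prepend[of i "E \<inter> Dset N A i"] by simp
qed

lemma distr_shift:
  assumes "i < N"
  shows "distr (density M (\<lambda>x. ennreal (indicator (Rset N A i) x))) M shift
       = density M (\<lambda>x. ennreal (ratio * indicator (Dset N A i) x))"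
proof (rule measure_eqI)
  fix E assume "E \<in> sets (distr (density M (\<lambda>x. ennreal (indicator (Rset N A i) x))) M shift)"
  then have E [measurable]: "E \<in> sets M" by simp
  have "emeasure (distr (density M (\<lambda>x. ennreal (indicator (Rset N A i) x))) M shift) E
      = (\<integral>\<^sup>+x. indicator (Rset N A i \<inter> (shift -` E \<inter> space M)) x \<partial>M)"
    using measurable_sets[OF shift_measurable E]
    by (subst emeasure_distr)
      (auto simp: emeasure_density ennreal_indicator simp del: nn_integral_indicator
        intro!: nn_integral_cong split: split_indicator)
  also have "\<dots> = emeasure M (Rset N A i \<inter> (shift -` E \<inter> space M))"
    using E by (intro nn_integral_indicator) measurable
  also have "\<dots> = ennreal ratio * emeasure M (E \<inter> Dset N A i)"
    using emeasure_shift[OF assms E] .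
  also have "\<dots> = (\<integral>\<^sup>+x. ennreal ratio * indicator (E \<inter> Dset N A i) x \<partial>M)"
    by (simp add: nn_integral_cmult_indicator)
  also have "\<dots> = emeasure (density M (\<lambda>x. ennreal (ratio * indicator (Dset N A i) x))) E"
    using ratio_pos by (auto simp: emeasure_density intro!: nn_integral_cong split: split_indicator)
  finally show "emeasure (distr (density M (\<lambda>x. ennreal (indicator (Rset N A i) x))) M shift) E
      = emeasure (density M (\<lambda>x. ennreal (ratio * indicator (Dset N A i) x))) E" .
qed simp

text \<open>
  The change of variables \<open>y = \<sigma> x\<close> on \<open>R\<^sub>i\<close>. No integrability is assumed: both integrals take
  the default value 0 together.
\<close>
lemma integral_shift:
  fixes h :: "(nat \<Rightarrow> nat) \<Rightarrow> 'b::{banach, second_countable_topology}"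
  assumes "i < N" and [measurable]: "h \<in> borel_measurable M"
  shows "(\<integral>x. indicator (Rset N A i) x *\<^sub>R h (shift x) \<partial>M)
       = (\<integral>x. (ratio * indicator (Dset N A i) x) *\<^sub>R h x \<partial>M)" (is ?int)
    and "integrable M (\<lambda>x. indicator (Rset N A i) x *\<^sub>R h (shift x))
       \<longleftrightarrow> integrable M (\<lambda>x. (ratio * indicator (Dset N A i) x) *\<^sub>R h x)" (is ?able)
proof -
  let ?D = "density M (\<lambda>x. ennreal (indicator (Rset N A i) x))"
  have sh: "shift \<in> measurable ?D M" by simp
  have hD: "(\<lambda>x. h (shift x)) \<in> borel_measurable M" by measurable
  have "(\<integral>x. indicator (Rset N A i) x *\<^sub>R h (shift x) \<partial>M) = (\<integral>x. h (shift x) \<partial>?D)"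
    using hD by (intro integral_density[symmetric]) auto
  also have "\<dots> = (\<integral>x. h x \<partial>distr ?D M shift)"
    using sh assms(2) by (rule integral_distr[symmetric])
  also have "\<dots> = (\<integral>x. (ratio * indicator (Dset N A i) x) *\<^sub>R h x \<partial>M)"
    unfolding distr_shift[OF assms(1)] using ratio_pos by (intro integral_density) auto
  finally show ?int .
  have "integrable M (\<lambda>x. indicator (Rset N A i) x *\<^sub>R h (shift x)) \<longleftrightarrow> integrable ?D (\<lambda>x. h (shift x))"
    using hD by (intro integrable_density[symmetric]) auto
  also have "\<dots> \<longleftrightarrow> integrable (distr ?D M shift) h"
    using sh assms(2) by (rule integrable_distr_eq[symmetric])
  also have "\<dots> \<longleftrightarrow> integrable M (\<lambda>x. (ratio * indicator (Dset N A i) x) *\<^sub>R h x)"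
    unfolding distr_shift[OF assms(1)] using ratio_pos by (intro integrable_density) auto
  finally show ?able .
qed

lemma AE_shift:
  assumes "i < N" "AE y in M. y \<in> Dset N A i \<longrightarrow> P y"
  shows "AE x in M. x \<in> Rset N A i \<longrightarrow> P (shift x)"
proof -
  obtain Z where Z: "{y \<in> space M. \<not> (y \<in> Dset N A i \<longrightarrow> P y)} \<subseteq> Z" "emeasure M Z = 0" "Z \<in> sets M"
    using AE_E[OF assms(2)] by blast
  have "emeasure M (Z \<inter> Dset N A i) \<le> emeasure M Z"
    using Z(3) by (intro emeasure_mono) auto
  then have "emeasure M (Rset N A i \<inter> (shift -` Z \<inter> space M)) = 0"
    using emeasure_shift[OF assms(1) Z(3)] Z(2) by simp
  then have null: "Rset N A i \<inter> (shift -` Z \<inter> space M) \<in> null_sets M"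
    using Z(3) by (intro null_setsI) measurable
  have "y \<in> Z" if "y \<in> Dset N A i" "\<not> P y" for y
    using Z(1) that by (auto simp: in_Dset)
  then show ?thesis
    using shift_Dset by (intro AE_I'[OF null]) auto
qed

lemma prepend_measurable:
  assumes "i < N"
  shows "prepend i \<in> measurable (restrict_space M (Dset N A i)) M"
proof (rule measurable_sigma_sets[OF sets_M])
  have DL: "Dset N A i \<subseteq> Lam N A" by (auto simp: in_Dset)
  show "range (cylinder N A) \<subseteq> Pow (Lam N A)" using cylinder_subset_Lam by auto
  show "prepend i \<in> space (restrict_space M (Dset N A i)) \<rightarrow> Lam N A"
    using prepend_Rset[OF assms] cylinder_subset_Lam by (force simp: space_restrict_space)
  fix E assume "E \<in> range (cylinder N A)"
  then obtain b where E: "E = cylinder N A b" by auto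
  have "prepend i -` E \<inter> Dset N A i = (case b of [] \<Rightarrow> Lam N A | j # b' \<Rightarrow>
      if i = j then cylinder N A b' else {}) \<inter> Dset N A i"
    using prepend_Rset[OF assms] cylinder_subset_Lam DL
    by (cases b) (force simp: E cylinder_Nil in_cylinder_Cons)+
  then show "prepend i -` E \<inter> space (restrict_space M (Dset N A i)) \<in> sets (restrict_space M (Dset N A i))"
    using DL sets.top[of M] by (simp add: space_restrict_space sets_restrict_space_iff Int_absorb2 split: list.split)
qed

lemma AE_prepend:
  assumes "i < N" "AE x in M. x \<in> Rset N A i \<longrightarrow> P x"
  shows "AE y in M. y \<in> Dset N A i \<longrightarrow> P (prepend i y)"
proof -
  obtain Z where Z: "{x \<in> space M. \<not> (x \<in> Rset N A i \<longrightarrow> P x)} \<subseteq> Z" "emeasure M Z = 0" "Z \<in> sets M"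
    using AE_E[OF assms(2)] by blast
  let ?E = "prepend i -` Z \<inter> Dset N A i"
  have DL: "Dset N A i \<subseteq> Lam N A" by (auto simp: in_Dset)
  have E: "?E \<in> sets M"
    using measurable_sets[OF prepend_measurable[OF assms(1)] Z(3)] DL
    by (simp add: space_restrict_space sets_restrict_space_iff Int_absorb2)
  have "ennreal ratio * emeasure M ?E = emeasure M (prepend i ` ?E)"
    using E by (intro emeasure_prepend[symmetric] assms(1)) auto
  also have "\<dots> \<le> emeasure M Z"
    using Z(3) by (intro emeasure_mono) auto
  finally have "emeasure M ?E = 0"
    using ratio_pos Z(2) by simp
  then have null: "?E \<in> null_sets M" using E by (intro null_setsI)
  have "x \<in> Z" if "x \<in> Rset N A i" "\<not> P x" for x
    using Z(1) that cylinder_subset_Lam by auto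
  then show ?thesis
    using prepend_Rset[OF assms(1)] by (intro AE_I'[OF null]) auto
qed

text \<open>The constant with \<open>S\<^sub>i f = \<kappa> \<chi>\<^sub>R\<^sub>i (f \<circ> \<sigma>)\<close> almost everywhere.\<close>
definition kappa :: real where "kappa = ratio powr (- 1 / 2)"

lemma kappa_pos: "kappa > 0"
  using ratio_pos by (simp add: kappa_def)

lemma kappa_sq: "ratio * (kappa * kappa) = 1"
  using ratio_pos by (simp add: kappa_def powr_add[symmetric] powr_minus_divide)

end

section \<open>The Cuntz--Krieger operators and their adjoints\<close>

locale finite_admissible = admissible + finite_measure "mu N A"
begin

text \<open>Finiteness of the measure gives uniqueness of the Radon--Nikodym derivative.\<close>
lemma Phi_AE:
  assumes "i < N"
  shows "AE y in M. y \<in> Dset N A i \<longrightarrow> Phi N A i y = ratio"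
proof -
  let ?D = "Dset N A i" and ?R = "restrict_space M (Dset N A i)"
  have DL: "?D \<subseteq> space M" by (auto simp: in_Dset)
  have spR: "space ?R = ?D" using DL by (auto simp: space_restrict_space)
  interpret R: finite_measure ?R
    by (rule finite_measure_restrict_space) (simp_all add: finite_measure_axioms)
  let ?d = "density ?R (\<lambda>_. ennreal ratio)"
  have "mu_sigma N A i = measure_of (space ?d) (sets ?d) (emeasure ?d)"
    unfolding mu_sigma_def space_density sets_density spR
  proof (rule measure_of_eq)
    show "sets ?R \<subseteq> Pow ?D" using sets.space_closed[of ?R] by (simp add: spR)
    fix E assume "E \<in> sigma_sets ?D (sets ?R)"
    then have E: "E \<in> sets ?R" using sets.sigma_sets_eq[of ?R] by (simp add: spR)
    then have E': "E \<in> sets M" "E \<subseteq> ?D" using DL by (auto simp: sets_restrict_space_iff Dset_Int_Lam)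
    show "emeasure M (prepend i ` E) = emeasure ?d E"
      using E E' DL by (simp add: emeasure_prepend[OF assms] emeasure_density_const emeasure_restrict_space Int_absorb2)
  qed
  then have "density ?R (\<lambda>_. ennreal ratio) = mu_sigma N A i"
    by (simp only: measure_of_of_measure)
  then have "AE y in ?R. ennreal ratio = RN_deriv ?R (mu_sigma N A i) y"
    by (intro R.RN_deriv_unique) auto
  then have "AE y in M. y \<in> ?D \<longrightarrow> ennreal ratio = RN_deriv ?R (mu_sigma N A i) y"
    using DL by (subst (asm) AE_restrict_space_iff) (auto simp: Int_absorb2)
  then show ?thesis
  proof eventually_elim
    case (elim y)
    then show ?case
      unfolding Phi_def using ratio_pos enn2real_ennreal[of ratio] by (metis less_imp_le)
  qed
qed

lemma Sop_measurable:
  assumes [measurable]: "f \<in> borel_measurable M"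
  shows "Sop N A i f \<in> borel_measurable M"
proof -
  have "Phi N A i \<in> borel_measurable (restrict_space M (Dset N A i))"
    unfolding Phi_def by measurable
  then have [measurable]: "(\<lambda>y. indicator (Dset N A i) y *\<^sub>R Phi N A i y) \<in> borel_measurable M"
    by (subst (asm) borel_measurable_restrict_space_iff) (auto simp: Dset_Int_Lam)
  have "Sop N A i f = (\<lambda>x. indicator (Rset N A i) x *
      complex_of_real ((indicator (Dset N A i) (shift x) *\<^sub>R Phi N A i (shift x)) powr (- 1 / 2)) * f (shift x))"
    using shift_Dset by (auto simp: Sop_def fun_eq_iff split: split_indicator)
  moreover have "(\<lambda>x. indicator (Rset N A i) x *
      complex_of_real ((indicator (Dset N A i) (shift x) *\<^sub>R Phi N A i (shift x)) powr (- 1 / 2)) * f (shift x))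
    \<in> borel_measurable M"
    by measurable
  ultimately show ?thesis by simp
qed

lemma Sop_AE:
  assumes "i < N"
  shows "AE x in M. Sop N A i f x = indicator (Rset N A i) x *\<^sub>R (complex_of_real kappa * f (shift x))"
  using AE_shift[OF assms Phi_AE[OF assms]]
  by eventually_elim (auto simp: Sop_def kappa_def split: split_indicator)

lemma Sop_inner:
  assumes "i < N" and [measurable]: "u \<in> borel_measurable M" "v \<in> borel_measurable M"
  shows "l2_inner M (Sop N A i u) (Sop N A i v) = (\<integral>x. indicator (Dset N A i) x *\<^sub>R (cnj (u x) * v x) \<partial>M)"
proof -
  note [measurable] = assms(2,3)[THEN Sop_measurable]
  define h where "h y = complex_of_real (kappa * kappa) * (cnj (u y) * v y)" for y
  have [measurable]: "h \<in> borel_measurable M" unfolding h_def by measurable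
  have "l2_inner M (Sop N A i u) (Sop N A i v) = (\<integral>x. indicator (Rset N A i) x *\<^sub>R h (shift x) \<partial>M)"
    unfolding l2_inner_def
  proof (rule integral_cong_AE)
    show "AE x in M. cnj (Sop N A i u x) * Sop N A i v x = indicator (Rset N A i) x *\<^sub>R h (shift x)"
      using Sop_AE[OF assms(1), of u] Sop_AE[OF assms(1), of v]
      by eventually_elim (auto simp: h_def split: split_indicator)
  qed measurable
  also have "\<dots> = (\<integral>x. (ratio * indicator (Dset N A i) x) *\<^sub>R h x \<partial>M)"
    by (rule integral_shift(1)[OF assms(1)]) measurable
  also have "(\<lambda>x. (ratio * indicator (Dset N A i) x) *\<^sub>R h x) = (\<lambda>x. indicator (Dset N A i) x *\<^sub>R (cnj (u x) * v x))"
  proof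
    fix x
    show "(ratio * indicator (Dset N A i) x) *\<^sub>R h x = indicator (Dset N A i) x *\<^sub>R (cnj (u x) * v x)"
    proof -
      have "complex_of_real ratio * h x = complex_of_real (ratio * (kappa * kappa)) * (cnj (u x) * v x)"
        unfolding h_def by (simp add: mult.assoc)
      then show ?thesis unfolding kappa_sq by (auto simp: scaleR_conv_of_real split: split_indicator)
    qed
  qed
  finally show ?thesis .
qed

lemma Sop_L2:
  assumes "i < N" "f \<in> L2 M"
  shows "Sop N A i f \<in> L2 M"
proof (rule L2_I)
  note [measurable] = L2_measurable[OF assms(2)]
  show m [measurable]: "Sop N A i f \<in> borel_measurable M"
    by (rule Sop_measurable) measurable
  define h where "h y = (kappa * kappa) * (cmod (f y))\<^sup>2" for y
  have [measurable]: "h \<in> borel_measurable M" unfolding h_def by measurable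
  have "integrable M (\<lambda>x. indicator (Dset N A i) x *\<^sub>R (cmod (f x))\<^sup>2)"
    using L2_sq_integrable[OF assms(2)] by (intro integrable_mult_indicator) auto
  also have "(\<lambda>x. indicator (Dset N A i) x *\<^sub>R (cmod (f x))\<^sup>2) = (\<lambda>x. (ratio * indicator (Dset N A i) x) *\<^sub>R h x)"
    using kappa_sq by (auto simp: h_def fun_eq_iff mult.assoc[symmetric] split: split_indicator)
  finally have "integrable M (\<lambda>x. indicator (Rset N A i) x *\<^sub>R h (shift x))"
    by (subst integral_shift(2)[OF assms(1)]) auto
  moreover have "AE x in M. indicator (Rset N A i) x *\<^sub>R h (shift x) = (cmod (Sop N A i f x))\<^sup>2"
    using Sop_AE[OF assms(1), of f]
    by eventually_elim (auto simp: h_def norm_mult power_mult_distrib power2_eq_square split: split_indicator)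
  ultimately show "integrable M (\<lambda>x. (cmod (Sop N A i f x))\<^sup>2)"
    by (subst (asm) integrable_cong_AE) auto
qed

lemma Sop_norm_le:
  assumes "i < N" "f \<in> L2 M"
  shows "l2_norm M (Sop N A i f) \<le> l2_norm M f"
proof -
  have eq: "cnj (f x) * f x = complex_of_real ((cmod (f x))\<^sup>2)" for x
    by (simp only: complex_norm_square mult.commute)
  have "complex_of_real ((l2_norm M (Sop N A i f))\<^sup>2)
      = (\<integral>x. complex_of_real (indicator (Dset N A i) x *\<^sub>R (cmod (f x))\<^sup>2) \<partial>M)"
    unfolding l2_norm_sq_eq_inner Sop_inner[OF assms(1) L2_measurable[OF assms(2)] L2_measurable[OF assms(2)]] eq
    by (intro Bochner_Integration.integral_cong) (auto split: split_indicator)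
  then have "(l2_norm M (Sop N A i f))\<^sup>2 = (\<integral>x. indicator (Dset N A i) x *\<^sub>R (cmod (f x))\<^sup>2 \<partial>M)"
    unfolding integral_complex_of_real of_real_eq_iff .
  also have "\<dots> \<le> (l2_norm M f)\<^sup>2"
    unfolding l2_norm_sq
    by (rule integral_mono) (use L2_sq_integrable[OF assms(2)] in
        \<open>auto intro!: integrable_mult_indicator[where f = "\<lambda>x. (cmod (f x))\<^sup>2", simplified] split: split_indicator\<close>)
  finally show ?thesis
    using l2_norm_nonneg by (rule power2_le_imp_le)
qed

text \<open>
  The adjoint \<open>S\<^sub>i\<^sup>*\<close> of \<open>S\<^sub>i\<close>, written with the constant \<open>\<kappa>\<close> in place of the almost
  everywhere equal function \<open>\<Phi>\<^sub>\<sigma>\<^sub>i\<close> to the power \<open>-1/2\<close>.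
\<close>
definition Tadj :: "nat \<Rightarrow> ((nat \<Rightarrow> nat) \<Rightarrow> complex) \<Rightarrow> (nat \<Rightarrow> nat) \<Rightarrow> complex" where
  "Tadj i g x = (if x \<in> Dset N A i then complex_of_real (1 / kappa) * g (prepend i x) else 0)"

lemma prepend_comp_measurable:
  fixes g :: "(nat \<Rightarrow> nat) \<Rightarrow> 'b::real_normed_vector"
  assumes "i < N" "g \<in> borel_measurable M"
  shows "(\<lambda>x. indicator (Dset N A i) x *\<^sub>R g (prepend i x)) \<in> borel_measurable M"
  using measurable_comp[OF prepend_measurable[OF assms(1)] assms(2)]
  by (subst (asm) borel_measurable_restrict_space_iff) (auto simp: comp_def Dset_Int_Lam)

lemma Tadj_conv:
  "Tadj i g x = complex_of_real (1 / kappa) * (indicator (Dset N A i) x *\<^sub>R g (prepend i x))"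
  by (simp add: Tadj_def)

lemma Tadj_L2:
  assumes "i < N" "g \<in> L2 M"
  shows "Tadj i g \<in> L2 M"
proof (rule L2_I)
  note [measurable] = prepend_comp_measurable[OF assms(1) L2_measurable[OF assms(2)]]
    L2_measurable[OF assms(2)]
  show m [measurable]: "Tadj i g \<in> borel_measurable M"
    unfolding Tadj_conv by measurable
  define h where "h y = (cmod (indicator (Dset N A i) y *\<^sub>R g (prepend i y)))\<^sup>2" for y
  have [measurable]: "h \<in> borel_measurable M" unfolding h_def by measurable
  have "integrable M (\<lambda>x. indicator (Rset N A i) x *\<^sub>R (cmod (g x))\<^sup>2)"
    using L2_sq_integrable[OF assms(2)] by (intro integrable_mult_indicator) auto
  also have "(\<lambda>x. indicator (Rset N A i) x *\<^sub>R (cmod (g x))\<^sup>2) = (\<lambda>x. indicator (Rset N A i) x *\<^sub>R h (shift x))"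
  proof
    fix x
    show "indicator (Rset N A i) x *\<^sub>R (cmod (g x))\<^sup>2 = indicator (Rset N A i) x *\<^sub>R h (shift x)"
      using shift_Dset[of x i] prepend_shift[of x]
      by (auto simp: h_def in_Rset split: split_indicator)
  qed
  finally have "integrable M (\<lambda>x. (ratio * indicator (Dset N A i) x) *\<^sub>R h x)"
    by (subst (asm) integral_shift(2)[OF assms(1)]) auto
  also have "(\<lambda>x. (ratio * indicator (Dset N A i) x) *\<^sub>R h x) = (\<lambda>x. (cmod (Tadj i g x))\<^sup>2)"
  proof
    have "1 / kappa * (1 / kappa) = ratio"
      using kappa_sq kappa_pos by (simp add: field_simps)
    then have "(cmod (complex_of_real (1 / kappa)))\<^sup>2 = ratio"
      using kappa_pos by (simp only: norm_of_real power2_eq_square abs_of_pos zero_less_divide_1_iff)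
    then show "(ratio * indicator (Dset N A i) x) *\<^sub>R h x = (cmod (Tadj i g x))\<^sup>2" for x
      unfolding Tadj_conv h_def norm_mult power_mult_distrib by (auto split: split_indicator)
  qed
  finally show "integrable M (\<lambda>x. (cmod (Tadj i g x))\<^sup>2)" .
qed

lemma Sop_adjoint:
  assumes "i < N" "u \<in> L2 M" "g \<in> L2 M"
  shows "l2_inner M (Sop N A i u) g = l2_inner M u (Tadj i g)"
proof -
  note [measurable] = prepend_comp_measurable[OF assms(1) L2_measurable[OF assms(3)]]
    L2_measurable[OF assms(2)] L2_measurable[OF assms(3)]
    L2_measurable[OF Sop_L2[OF assms(1,2)]]
  define h where "h y = complex_of_real kappa * cnj (u y) * (indicator (Dset N A i) y *\<^sub>R g (prepend i y))" for y
  have [measurable]: "h \<in> borel_measurable M" unfolding h_def by measurable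
  have "l2_inner M (Sop N A i u) g = (\<integral>x. indicator (Rset N A i) x *\<^sub>R h (shift x) \<partial>M)"
    unfolding l2_inner_def
  proof (rule integral_cong_AE)
    show "AE x in M. cnj (Sop N A i u x) * g x = indicator (Rset N A i) x *\<^sub>R h (shift x)"
      using Sop_AE[OF assms(1), of u]
    proof eventually_elim
      case (elim x)
      then show ?case
        using shift_Dset[of x i] prepend_shift[of x]
        by (auto simp: h_def in_Rset split: split_indicator)
    qed
  qed measurable
  also have "\<dots> = (\<integral>x. (ratio * indicator (Dset N A i) x) *\<^sub>R h x \<partial>M)"
    by (rule integral_shift(1)[OF assms(1)]) measurable
  also have "(\<lambda>x. (ratio * indicator (Dset N A i) x) *\<^sub>R h x) = (\<lambda>x. cnj (u x) * Tadj i g x)"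
  proof
    fix x
    have "ratio * kappa = 1 / kappa"
      using kappa_sq kappa_pos by (simp add: field_simps)
    then have "complex_of_real ratio * complex_of_real kappa = complex_of_real (1 / kappa)"
      by (metis of_real_mult)
    then show "(ratio * indicator (Dset N A i) x) *\<^sub>R h x = cnj (u x) * Tadj i g x"
      by (auto simp: h_def Tadj_conv scaleR_conv_of_real mult.assoc[symmetric] split: split_indicator)
  qed
  finally show ?thesis unfolding l2_inner_def .
qed

lemma Sop_Tadj:
  assumes "i < N"
  shows "AE x in M. Sop N A i (Tadj i g) x = indicator (Rset N A i) x *\<^sub>R g x"
  using Sop_AE[OF assms, of "Tadj i g"]
proof eventually_elim
  case (elim x)
  then show ?case
    using shift_Dset[of x i] prepend_shift[of x] kappa_pos
    by (auto simp: Tadj_conv in_Rset split: split_indicator)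
qed

end

section \<open>Functions constant on cylinders\<close>

context admissible
begin

lemma finite_words: "finite (words N A k)"
  by (rule finite_subset[OF _ finite_lists_length_eq[of "{..<N}" k]]) (auto simp: words_def)

lemma prefix_in_words: "x \<in> Lam N A \<Longrightarrow> map x [0..<k] \<in> words N A k"
  by (auto simp: words_def Lam_def)

lemma in_cylinder_iff_prefix:
  "length a = k \<Longrightarrow> x \<in> cylinder N A a \<longleftrightarrow> x \<in> Lam N A \<and> a = map x [0..<k]"
  by (auto simp: cylinder_def list_eq_iff_nth_eq)

lemma words_length: "a \<in> words N A k \<Longrightarrow> length a = k"
  by (simp add: words_def)

lemma words_ConsD:
  "i # b \<in> words N A (Suc k) \<Longrightarrow> i < N \<and> b \<in> words N A k \<and> (b \<noteq> [] \<longrightarrow> A i (hd b) = 1)"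
  by (force simp: words_def hd_conv_nth)

lemma words_Cons:
  assumes "i < N" "b \<in> words N A k" "b = [] \<or> A i (hd b) = 1"
  shows "i # b \<in> words N A (Suc k)"
proof -
  have "A ((i # b) ! n) ((i # b) ! Suc n) = 1" if "Suc n < Suc k" for n
    using that assms by (cases n) (auto simp: words_def hd_conv_nth)
  then show ?thesis using assms by (simp add: words_def)
qed

lemma words_take: "a \<in> words N A m \<Longrightarrow> k \<le> m \<Longrightarrow> take k a \<in> words N A k"
  by (auto simp: words_def dest: in_set_takeD)

lemma sum_over_cylinders:
  fixes c :: "nat list \<Rightarrow> complex"
  assumes "x \<in> Lam N A"
  shows "(\<Sum>b\<in>words N A k. c b * indicator (cylinder N A b) x) = c (map x [0..<k])"
proof -
  have "(\<Sum>b\<in>words N A k. c b * indicator (cylinder N A b) x)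
      = (\<Sum>b\<in>words N A k. if b = map x [0..<k] then c b else 0)"
    by (rule sum.cong) (auto simp: in_cylinder_iff_prefix[OF words_length] assms)
  also have "\<dots> = c (map x [0..<k])"
    using finite_words prefix_in_words[OF assms] by (simp add: sum.delta)
  finally show ?thesis .
qed

lemma Sspace_L2: "f \<in> Sspace N A k \<Longrightarrow> f \<in> L2 M"
  by (simp add: Sspace_def)

lemma Sspace_mono:
  assumes "f \<in> Sspace N A k" "k \<le> m"
  shows "f \<in> Sspace N A m"
proof -
  have "\<exists>c. AE x in M. x \<in> cylinder N A a \<longrightarrow> f x = c" if a: "a \<in> words N A m" for a
  proof -
    obtain c where "AE x in M. x \<in> cylinder N A (take k a) \<longrightarrow> f x = c"
      using assms words_take[OF a] unfolding Sspace_def by blast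
    then have "AE x in M. x \<in> cylinder N A a \<longrightarrow> f x = c"
      by eventually_elim (auto simp: cylinder_def)
    then show ?thesis by blast
  qed
  then show ?thesis using assms(1) by (simp add: Sspace_def)
qed

lemma Sspace_diff:
  assumes "f \<in> Sspace N A k" "g \<in> Sspace N A k"
  shows "(\<lambda>x. f x - g x) \<in> Sspace N A k"
proof -
  have "\<exists>c. AE x in M. x \<in> cylinder N A a \<longrightarrow> f x - g x = c" if a: "a \<in> words N A k" for a
  proof -
    obtain c d where "AE x in M. x \<in> cylinder N A a \<longrightarrow> f x = c" "AE x in M. x \<in> cylinder N A a \<longrightarrow> g x = d"
      using assms a unfolding Sspace_def by blast
    then have "AE x in M. x \<in> cylinder N A a \<longrightarrow> f x - g x = c - d"
      by eventually_elim auto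
    then show ?thesis by blast
  qed
  then show ?thesis using assms by (simp add: Sspace_def L2_diff)
qed

lemma Sspace_expand:
  assumes "h \<in> Sspace N A k"
  obtains c where "AE x in M. h x = (\<Sum>b\<in>words N A k. c b * indicator (cylinder N A b) x)"
proof -
  obtain c where c: "\<And>b. b \<in> words N A k \<Longrightarrow> AE x in M. x \<in> cylinder N A b \<longrightarrow> h x = c b"
    using assms unfolding Sspace_def by (auto dest!: bchoice)
  have "AE x in M. \<forall>b\<in>words N A k. x \<in> cylinder N A b \<longrightarrow> h x = c b"
    using finite_words c by (intro AE_finite_allI)
  then have "AE x in M. h x = (\<Sum>b\<in>words N A k. c b * indicator (cylinder N A b) x)"
    using AE_space
  proof eventually_elim
    case (elim x)
    then have "x \<in> Lam N A" by simp
    then have "h x = c (map x [0..<k])"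
      using elim(1) prefix_in_words[of x k] by (auto simp: in_cylinder_iff_prefix)
    then show ?case using sum_over_cylinders[OF \<open>x \<in> Lam N A\<close>] by simp
  qed
  then show thesis by (rule that)
qed

lemma cylinder_Int:
  assumes "length a \<le> length b"
  shows "cylinder N A a \<inter> cylinder N A b = (if take (length a) b = a then cylinder N A b else {})"
proof (cases "take (length a) b = a")
  case True
  then have "a ! i = b ! i" if "i < length a" for i
    using that by (metis nth_take)
  then show ?thesis using True assms by (auto simp: cylinder_def)
next
  case False
  then obtain i where "i < length a" "b ! i \<noteq> a ! i"
    using assms by (auto simp: list_eq_iff_nth_eq)
  then show ?thesis using False assms by (auto simp: cylinder_def)
qed

lemma Int_stable_cylinders: "Int_stable (range (cylinder N A))"
proof -
  \<comment> \<open>The letter \<open>N\<close> is out of range, so the empty set is also a cylinder.\<close>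
  have N: "cylinder N A [N] = {}"
    by (auto simp: cylinder_def Lam_def)
  have le: "cylinder N A a \<inter> cylinder N A b \<in> range (cylinder N A)" if "length a \<le> length b" for a b
    unfolding cylinder_Int[OF that] using N by (metis rangeI)
  have "cylinder N A a \<inter> cylinder N A b \<in> range (cylinder N A)" for a b
    using le[of a b] le[of b a] by (metis Int_commute nat_le_linear)
  then show ?thesis by (auto simp: Int_stable_def)
qed

lemma indicator_Sspace_finite:
  assumes "length a \<le> k" "emeasure M (cylinder N A a) < \<infinity>"
  shows "(indicator (cylinder N A a) :: _ \<Rightarrow> complex) \<in> Sspace N A k"
proof -
  have "\<exists>c. AE x in M. x \<in> cylinder N A b \<longrightarrow> indicator (cylinder N A a) x = (c :: complex)"
    if b: "b \<in> words N A k" for b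
  proof (cases "take (length a) b = a")
    case True
    then have "cylinder N A b \<subseteq> cylinder N A a"
      using cylinder_Int[of a b] assms words_length[OF b] by auto
    then show ?thesis by (intro exI[of _ 1] AE_I2) (auto split: split_indicator)
  next
    case False
    then have "cylinder N A a \<inter> cylinder N A b = {}"
      using cylinder_Int[of a b] assms words_length[OF b] by auto
    then show ?thesis by (intro exI[of _ 0] AE_I2) (auto split: split_indicator)
  qed
  then show ?thesis using assms(2) by (simp add: Sspace_def indicator_L2_finite)
qed

end

section \<open>Projections onto the spaces of locally constant functions and their density\<close>

context finite_admissible
begin

lemma indicator_L2:
  "E \<in> sets M \<Longrightarrow> (indicator E :: _ \<Rightarrow> complex) \<in> L2 M"
  by (rule indicator_L2_finite) (simp_all add: less_top[symmetric] emeasure_finite)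

lemma Sspace_orthI:
  assumes "g \<in> L2 M" "\<And>b. b \<in> words N A k \<Longrightarrow> l2_inner M (indicator (cylinder N A b)) g = 0"
    and "h \<in> Sspace N A k"
  shows "l2_inner M h g = 0"
proof -
  obtain c where c: "AE x in M. h x = (\<Sum>b\<in>words N A k. c b * indicator (cylinder N A b) x)"
    using Sspace_expand[OF assms(3)] by blast
  have "l2_inner M h g = l2_inner M (\<lambda>x. \<Sum>b\<in>words N A k. c b * indicator (cylinder N A b) x) g"
    using c by (intro l2_inner_cong_AE)
      (auto simp: assms(1) L2_measurable Sspace_L2[OF assms(3)] elim!: eventually_mono)
  also have "\<dots> = (\<Sum>b\<in>words N A k. cnj (c b) * l2_inner M (indicator (cylinder N A b)) g)"
    by (rule l2_inner_sum_left) (auto simp: indicator_L2 assms(1))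
  also have "\<dots> = 0" using assms(2) by simp
  finally show ?thesis .
qed

lemma indicator_Sspace:
  "length a \<le> k \<Longrightarrow> (indicator (cylinder N A a) :: _ \<Rightarrow> complex) \<in> Sspace N A k"
  by (rule indicator_Sspace_finite) (simp_all add: less_top[symmetric] emeasure_finite)

text \<open>
  The orthogonal projection onto \<open>\<SS>\<^sub>k\<close>: on each cylinder, the mean of \<open>g\<close>. Division by zero
  gives the value 0 on cylinders of measure zero.
\<close>
definition Proj :: "nat \<Rightarrow> ((nat \<Rightarrow> nat) \<Rightarrow> complex) \<Rightarrow> (nat \<Rightarrow> nat) \<Rightarrow> complex" where
  "Proj k g x = (\<Sum>b\<in>words N A k. l2_inner M (indicator (cylinder N A b)) g
      / complex_of_real (measure M (cylinder N A b)) * indicator (cylinder N A b) x)"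

lemma Proj_on_cylinder:
  assumes "b \<in> words N A k" "x \<in> cylinder N A b"
  shows "Proj k g x = l2_inner M (indicator (cylinder N A b)) g / complex_of_real (measure M (cylinder N A b))"
proof -
  have x: "x \<in> Lam N A" "b = map x [0..<k]"
    using assms(2) in_cylinder_iff_prefix[OF words_length[OF assms(1)]] by auto
  show ?thesis
    unfolding Proj_def sum_over_cylinders[OF x(1)] x(2)[symmetric] ..
qed

lemma Proj_Sspace: "Proj k g \<in> Sspace N A k"
proof -
  have "Proj k g \<in> L2 M"
    unfolding Proj_def by (intro L2_sum L2_scale indicator_L2) simp
  moreover have "\<exists>c. AE x in M. x \<in> cylinder N A b \<longrightarrow> Proj k g x = c" if b: "b \<in> words N A k" for b
    using Proj_on_cylinder[OF b] by (intro exI AE_I2 impI)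
  ultimately show ?thesis by (simp add: Sspace_def)
qed

lemma Proj_orth:
  assumes g: "g \<in> L2 M" and h: "h \<in> Sspace N A k"
  shows "l2_inner M h (\<lambda>x. g x - Proj k g x) = 0"
proof (rule Sspace_orthI[OF _ _ h])
  have P: "Proj k g \<in> L2 M" by (rule Sspace_L2[OF Proj_Sspace])
  then show "(\<lambda>x. g x - Proj k g x) \<in> L2 M" using g by (intro L2_diff)
  fix b assume b: "b \<in> words N A k"
  let ?c = "l2_inner M (indicator (cylinder N A b)) g / complex_of_real (measure M (cylinder N A b))"
  have "l2_inner M (indicator (cylinder N A b)) (Proj k g) = (\<integral>x. ?c * indicator (cylinder N A b) x \<partial>M)"
    unfolding l2_inner_def[of M _ "Proj k g"]
    using Proj_on_cylinder[OF b]
    by (intro Bochner_Integration.integral_cong refl) (auto split: split_indicator)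
  also have "\<dots> = ?c * (\<integral>x. complex_of_real (indicator (cylinder N A b) x) \<partial>M)"
    by (simp only: of_real_indicator integral_mult_right_zero)
  also have "\<dots> = ?c * complex_of_real (measure M (cylinder N A b))"
    unfolding integral_complex_of_real by (simp add: Int_absorb2[OF cylinder_subset_Lam])
  also have "\<dots> = l2_inner M (indicator (cylinder N A b)) g"
  proof (cases "measure M (cylinder N A b) = 0")
    case True
    then have "AE x in M. x \<notin> cylinder N A b"
      by (intro AE_not_in null_setsI) (simp_all add: emeasure_eq_measure)
    then have "l2_inner M (indicator (cylinder N A b)) g = l2_inner M (\<lambda>x. 0) g"
      by (intro l2_inner_cong_AE) (auto simp: L2_measurable[OF g] elim!: eventually_mono)
    then show ?thesis using True by (simp add: l2_inner_def)
  qed simp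
  finally show "l2_inner M (indicator (cylinder N A b)) (\<lambda>x. g x - Proj k g x) = 0"
    using g P by (subst l2_inner_diff_right) (auto simp: indicator_L2)
qed

lemma Proj_best:
  assumes g: "g \<in> L2 M" and h: "h \<in> Sspace N A k"
  shows "l2_norm M (\<lambda>x. g x - Proj k g x) \<le> l2_norm M (\<lambda>x. g x - h x)"
proof -
  have d: "(\<lambda>x. Proj k g x - h x) \<in> Sspace N A k"
    by (intro Sspace_diff Proj_Sspace h)
  have "(l2_norm M (\<lambda>x. (g x - Proj k g x) + (Proj k g x - h x)))\<^sup>2
     = (l2_norm M (\<lambda>x. g x - Proj k g x))\<^sup>2 + (l2_norm M (\<lambda>x. Proj k g x - h x))\<^sup>2"
    by (intro l2_norm_Pythagoras L2_diff g Sspace_L2[OF Proj_Sspace] Sspace_L2[OF h] Proj_orth[OF g d])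
  then have "(l2_norm M (\<lambda>x. g x - Proj k g x))\<^sup>2 \<le> (l2_norm M (\<lambda>x. g x - h x))\<^sup>2"
    by simp
  then show ?thesis using l2_norm_nonneg by (rule power2_le_imp_le)
qed

lemma indicator_in_cylinder_span:
  assumes "E \<in> sets M"
  shows "in_closed_span M UNIV (\<lambda>a. indicator (cylinder N A a)) (indicator E)"
proof -
  note Int_stable_cylinders
  moreover have "range (cylinder N A) \<subseteq> Pow (Lam N A)"
    using cylinder_subset_Lam by auto
  moreover have "E \<in> sigma_sets (Lam N A) (range (cylinder N A))"
    using assms by (simp add: sets_M)
  ultimately show ?thesis
  proof (induction rule: sigma_sets_induct_disjoint)
    case (basic E)
    then obtain a where "E = cylinder N A a" by auto
    then show ?case using closed_span_base[of a UNIV M "\<lambda>a. indicator (cylinder N A a)"] by simp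
  next
    case empty
    show ?case by (rule closed_span_null) auto
  next
    case (compl E)
    then have E [simp]: "E \<in> sets M" by (simp add: sets_M)
    have "in_closed_span M UNIV (\<lambda>a. indicator (cylinder N A a))
        (\<lambda>x. indicator (cylinder N A []) x + (-1) * indicator E x)"
      using compl(2) closed_span_base[of "[]" UNIV M "\<lambda>a. indicator (cylinder N A a)"]
      by (intro closed_span_add closed_span_scale L2_scale) (auto intro: indicator_L2)
    then show ?case
    proof (rule closed_span_cong_AE)
      show "AE x in M. indicator (Lam N A - E) x
          = indicator (cylinder N A []) x + (-1) * (indicator E x :: complex)"
        by (intro AE_I2) (auto simp: cylinder_Nil split: split_indicator)
    qed (use sets.Diff[OF sets.top E] in \<open>auto intro!: indicator_L2 L2_diff\<close>)
  next
    case (union F)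
    then have F: "\<And>n. F n \<in> sets M" by (auto simp: sets_M)
    define s :: "nat \<Rightarrow> (nat \<Rightarrow> nat) \<Rightarrow> complex" where "s n x = (\<Sum>i<n. indicator (F i) x)" for n x
    have s: "s n x = indicator (\<Union>i<n. F i) x" for n x
      unfolding s_def using union(1)
      by (intro indicator_UN_disjoint[symmetric]) (auto intro: disjoint_family_on_mono)
    show ?case
    proof (rule closed_span_limit)
      show L: "indicator (\<Union>i. F i) \<in> L2 M" using F by (intro indicator_L2) auto
      fix \<epsilon> :: real assume "\<epsilon> > 0"
      have "\<exists>n. l2_norm M (\<lambda>x. indicator (\<Union>i. F i) x - s n x) < \<epsilon>"
      proof (rule L2_truncation_limit[OF L])
        show "s n \<in> borel_measurable M" for n
          unfolding s_def using F by measurable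
        show "(\<lambda>n. s n x) \<longlonglongrightarrow> indicator (\<Union>i. F i) x" for x
          unfolding s by (rule LIMSEQ_indicator_UN)
        show "cmod (s n x) \<le> 2 * cmod (indicator (\<Union>i. F i) x)" for n x
          unfolding s by (auto split: split_indicator)
      qed fact
      moreover have "in_closed_span M UNIV (\<lambda>a. indicator (cylinder N A a)) (s n)" for n
        unfolding s_def using union(3) F by (intro closed_span_sum) (auto intro: indicator_L2)
      moreover have "s n \<in> L2 M" for n
        unfolding s_def using F by (intro L2_sum indicator_L2)
      ultimately show "\<exists>h\<in>L2 M. in_closed_span M UNIV (\<lambda>a. indicator (cylinder N A a)) h \<and>
          l2_norm M (\<lambda>x. indicator (\<Union>i. F i) x - h x) < \<epsilon>" by blast
    qed (auto intro: indicator_L2)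
  qed
qed

lemma L2_in_cylinder_span:
  assumes g: "g \<in> L2 M"
  shows "in_closed_span M UNIV (\<lambda>a. indicator (cylinder N A a)) g"
proof -
  obtain s where s: "\<And>n. simple_function M (s n)" "\<And>x. x \<in> space M \<Longrightarrow> (\<lambda>n. s n x) \<longlonglongrightarrow> g x"
      "\<And>n x. x \<in> space M \<Longrightarrow> dist (s n x) 0 \<le> 2 * dist (g x) 0"
    using borel_measurable_implies_sequence_metric[OF L2_measurable[OF g], of 0] by blast
  show ?thesis
  proof (rule closed_span_limit)
    fix \<epsilon> :: real assume "\<epsilon> > 0"
    have "\<exists>n. l2_norm M (\<lambda>x. g x - s n x) < \<epsilon>"
      by (rule L2_truncation_limit[OF g _ s(2) _ \<open>\<epsilon> > 0\<close>])
        (use s(1,3) in \<open>auto intro: borel_measurable_simple_function simp: dist_norm\<close>)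
    then obtain n where n: "l2_norm M (\<lambda>x. g x - s n x) < \<epsilon>" by blast
    define t where "t x = (\<Sum>y\<in>s n ` space M. y * indicator (s n -` {y} \<inter> space M) x)" for x
    have st: "s n x = t x" if "x \<in> space M" for x
      using simple_function_indicator_representation_banach[OF s(1) that, of n]
      unfolding t_def scaleR_conv_of_real of_real_indicator by (simp only: mult.commute)
    have lev: "s n -` {y} \<inter> space M \<in> sets M" for y
      using s(1) by (rule simple_functionD)
    have t: "t \<in> L2 M" unfolding t_def by (intro L2_sum L2_scale indicator_L2 lev)
    have "in_closed_span M UNIV (\<lambda>a. indicator (cylinder N A a)) t"
      unfolding t_def
      by (intro closed_span_sum closed_span_scale L2_scale indicator_L2 indicator_in_cylinder_span lev)
        simp
    moreover have "l2_norm M (\<lambda>x. g x - t x) = l2_norm M (\<lambda>x. g x - s n x)"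
      using st L2_measurable[OF g] L2_measurable[OF t] borel_measurable_simple_function[OF s(1), of n]
      by (intro l2_norm_cong_AE AE_I2) auto
    ultimately show "\<exists>h\<in>L2 M. in_closed_span M UNIV (\<lambda>a. indicator (cylinder N A a)) h \<and>
        l2_norm M (\<lambda>x. g x - h x) < \<epsilon>"
      using n t by auto
  qed (auto intro: indicator_L2 g)
qed

lemma Proj_tendsto:
  assumes g: "g \<in> L2 M" and "\<epsilon> > 0"
  shows "\<exists>k. l2_norm M (\<lambda>x. g x - Proj (Suc k) g x) < \<epsilon>"
proof -
  obtain F c where F: "finite F"
      "l2_norm M (\<lambda>x. g x - (\<Sum>a\<in>F. c a * indicator (cylinder N A a) x)) < \<epsilon>"
    using L2_in_cylinder_span[OF g] \<open>\<epsilon> > 0\<close> unfolding in_closed_span_def by blast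
  obtain k where k: "\<And>a. a \<in> F \<Longrightarrow> length a \<le> k"
    using finite_nat_set_iff_bounded_le[of "length ` F"] F(1) by auto
  have "(\<lambda>x. \<Sum>a\<in>F. c a * indicator (cylinder N A a) x) \<in> Sspace N A (Suc k)"
  proof -
    have "\<exists>d. AE x in M. x \<in> cylinder N A b \<longrightarrow> (\<Sum>a\<in>F. c a * indicator (cylinder N A a) x) = d"
      if b: "b \<in> words N A (Suc k)" for b
    proof -
      have "\<exists>d. AE x in M. x \<in> cylinder N A b \<longrightarrow> indicator (cylinder N A a) x = (d :: complex)"
        if "a \<in> F" for a
        using indicator_Sspace[of a "Suc k"] k[OF that] b unfolding Sspace_def by auto
      then obtain d :: "nat list \<Rightarrow> complex" where d: "\<And>a. a \<in> F \<Longrightarrow>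
          AE x in M. x \<in> cylinder N A b \<longrightarrow> indicator (cylinder N A a) x = d a"
        by metis
      then have "AE x in M. \<forall>a\<in>F. x \<in> cylinder N A b \<longrightarrow> indicator (cylinder N A a) x = d a"
        using F(1) by (intro AE_finite_allI)
      then have "AE x in M. x \<in> cylinder N A b \<longrightarrow>
          (\<Sum>a\<in>F. c a * indicator (cylinder N A a) x) = (\<Sum>a\<in>F. c a * d a)"
        by eventually_elim auto
      then show ?thesis by blast
    qed
    then show ?thesis
      unfolding Sspace_def by (auto intro!: L2_sum L2_scale indicator_L2)
  qed
  from Proj_best[OF g this] F(2) show ?thesis by (intro exI[of _ k]) simp
qed

end

section \<open>Mother wavelets force the measure to be finite\<close>

context admissible
begin

lemma mother_wavelet_formula:
  assumes "mother_wavelets N A c f" "(l, r) \<in> mother_index N A" "x \<in> Lam N A"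
  shows "f l r x = (\<Sum>j<N. of_nat (A r j) * c l r j * indicator (cylinder N A [r, j]) x)"
  using assms by (force simp: mother_wavelets_def)

lemma mother_wavelet_basis:
  assumes "mother_wavelets N A c f"
  shows "orthonormal_basis M (mother_index N A) (\<lambda>(l, r). f l r) (ominus M (Sspace N A 2) (Sspace N A 1))"
  using assms by (simp add: mother_wavelets_def)

lemma mother_wavelet_L2:
  assumes "mother_wavelets N A c f" "(l, r) \<in> mother_index N A"
  shows "f l r \<in> L2 M"
  using mother_wavelet_basis[OF assms(1)] assms(2) Sspace_L2
  by (fastforce simp: orthonormal_basis_iff ominus_def)

lemma mother_wavelet_inner:
  assumes "mother_wavelets N A c f" "(l, r) \<in> mother_index N A" "(l', r) \<in> mother_index N A"
  shows "l2_inner M (f l r) (f l' r) = (if l = l' then 1 else 0)"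
  using mother_wavelet_basis[OF assms(1)] assms(2,3)
  by (fastforce simp: orthonormal_basis_iff)

lemma mother_wavelet_support:
  assumes "mother_wavelets N A c f" "(l, r) \<in> mother_index N A" "x \<in> Lam N A" "f l r x \<noteq> 0"
  shows "x \<in> Rset N A r"
proof (rule ccontr)
  assume "x \<notin> Rset N A r"
  then have "x \<notin> cylinder N A [r, j]" for j
    by (auto simp: cylinder_def)
  then show False
    using assms(4) mother_wavelet_formula[OF assms(1-3)] by simp
qed

lemma mother_wavelet_const:
  assumes "mother_wavelets N A c f" "(l, r) \<in> mother_index N A" "j < N" "x \<in> cylinder N A [r, j]"
  shows "f l r x = of_nat (A r j) * c l r j"
proof -
  have "x \<in> Lam N A" using assms(4) cylinder_subset_Lam by auto
  then have "f l r x = (\<Sum>k<N. if k = j then of_nat (A r j) * c l r j else 0)"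
    unfolding mother_wavelet_formula[OF assms(1,2) \<open>x \<in> Lam N A\<close>]
    using assms(4) by (intro sum.cong) (auto simp: cylinder_def split: split_indicator)
  then show ?thesis using assms(3) by simp
qed

lemma Rset_partition: "Rset N A r = (\<Union>j<N. cylinder N A [r, j])"
proof (rule set_eqI, rule iffI)
  fix x assume "x \<in> Rset N A r"
  then have "x \<in> cylinder N A [r, x 1]" "x 1 < N"
    using Lam_step(1)[of x 1] by (auto simp: cylinder_def less_Suc_eq_0_disj)
  then show "x \<in> (\<Union>j<N. cylinder N A [r, j])" by blast
qed (auto simp: cylinder_def)

lemma Rset_outdeg_1:
  assumes "r < N" "A r r = 1" "outdeg N A r \<le> 1"
  shows "Rset N A r \<subseteq> {\<lambda>_. r}"
proof
  fix x assume x: "x \<in> Rset N A r"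
  have "\<forall>j\<in>{j. j < N \<and> A r j = 1}. \<forall>k\<in>{j. j < N \<and> A r j = 1}. j = k"
    using assms(3) by (subst card_le_Suc0_iff_eq[symmetric]) (auto simp: outdeg_def)
  then have succ: "j = r" if "j < N" "A r j = 1" for j
    using assms(1,2) that by blast
  have "x n = r" for n
  proof (induction n)
    case 0
    then show ?case using x by (simp add: in_Rset)
  next
    case (Suc n)
    then show ?case
      using x Lam_step(1)[of x "Suc n"] Lam_step(2)[of x n] by (intro succ) (auto simp: in_Rset)
  qed
  then show "x \<in> {\<lambda>_. r}" by auto
qed

text \<open>
  If \<open>R\<^sub>r\<close> has at most one outgoing letter, it is a point, and a point has measure at most 1.
  Otherwise there is a function \<open>f\<^sup>1\<^sup>,\<^sup>r\<close>. Suppose that \<open>R\<^sub>r\<close> has infinite measure. Being of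
  norm 1, \<open>f\<^sup>1\<^sup>,\<^sup>r\<close> is nonzero on some cylinder \<open>R\<^sub>r\<^sub>j\<close> of positive finite measure. The
  indicator of \<open>R\<^sub>r\<^sub>j\<close> lies in \<open>\<SS>\<^sub>2 \<ominus> \<SS>\<^sub>1\<close>, since the functions in \<open>\<SS>\<^sub>1\<close> vanish on \<open>R\<^sub>r\<close>.
  But all \<open>f\<^sup>l\<^sup>,\<^sup>r\<close> have integral zero over \<open>R\<^sub>r\<close>, so this indicator is not in their closed span.
\<close>
lemma Rset_finite_measure:
  assumes mw: "mother_wavelets N A c f" and r: "r < N" "A r r = 1"
  shows "emeasure M (Rset N A r) < \<infinity>"
proof (cases "outdeg N A r \<le> 1")
  case True
  then have "adic N ` Rset N A r \<subseteq> {adic N (\<lambda>_. r)}"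
    using Rset_outdeg_1[of r] r by auto
  then have "emeasure M (Rset N A r) \<le> 1"
    using emeasure_le_hausdorff hausdorff_outer_measure_subsingleton order_trans by blast
  also have "(1 :: ennreal) < \<infinity>" by simp
  finally show ?thesis .
next
  case False
  show ?thesis
  proof (rule ccontr)
    assume "\<not> emeasure M (Rset N A r) < \<infinity>"
    then have inf: "emeasure M (Rset N A r) = \<infinity>"
      by (simp add: not_less top_unique)
    have r1: "(1, r) \<in> mother_index N A" using False r by (simp add: mother_index_def)
    have zero_on_inf: "AE x in M. x \<in> cylinder N A [r, j] \<longrightarrow> f l r x = 0"
      if "(l, r) \<in> mother_index N A" "j < N" "emeasure M (cylinder N A [r, j]) = \<infinity>" for l j
      using L2_const_on_infinite[OF mother_wavelet_L2[OF mw that(1)] cylinder_sets that(3), of "of_nat (A r j) * c l r j"]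
        mother_wavelet_const[OF mw that(1,2)] by (intro AE_I2) auto
    have "\<exists>j<N. 0 < emeasure M (cylinder N A [r, j]) \<and> emeasure M (cylinder N A [r, j]) < \<infinity>"
    proof (rule ccontr)
      assume *: "\<not> ?thesis"
      have "AE x in M. \<forall>j\<in>{..<N}. x \<in> cylinder N A [r, j] \<longrightarrow> f 1 r x = 0"
      proof (rule AE_finite_allI)
        fix j assume "j \<in> {..<N}"
        then have j: "j < N" by simp
        show "AE x in M. x \<in> cylinder N A [r, j] \<longrightarrow> f 1 r x = 0"
        proof (cases "emeasure M (cylinder N A [r, j]) = \<infinity>")
          case True
          then show ?thesis by (rule zero_on_inf[OF r1 j])
        next
          case False
          then have "emeasure M (cylinder N A [r, j]) = 0"
            using * j by (auto simp: less_top not_gr_zero)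
          then have "AE x in M. x \<notin> cylinder N A [r, j]"
            by (intro AE_not_in null_setsI) simp_all
          then show ?thesis by eventually_elim simp
        qed
      qed simp
      then have "AE x in M. f 1 r x = 0"
        using AE_space
      proof eventually_elim
        case (elim x)
        then show ?case
          using mother_wavelet_support[OF mw r1, of x] Rset_partition[of r] by auto
      qed
      then have "l2_inner M (f 1 r) (f 1 r) = l2_inner M (\<lambda>x. 0) (\<lambda>x. 0)"
        using mother_wavelet_L2[OF mw r1] by (intro l2_inner_cong_AE) (auto simp: L2_measurable)
      then show False
        using mother_wavelet_inner[OF mw r1 r1] by (simp add: l2_inner_def)
    qed
    then obtain j0 where j0: "j0 < N" "0 < emeasure M (cylinder N A [r, j0])"
        "emeasure M (cylinder N A [r, j0]) < \<infinity>" by blast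
    define h :: "(nat \<Rightarrow> nat) \<Rightarrow> complex" where "h = indicator (cylinder N A [r, j0])"
    have h: "h \<in> Sspace N A 2"
      unfolding h_def using j0(3) by (intro indicator_Sspace_finite) simp_all
    have "l2_inner M g h = 0" if g: "g \<in> Sspace N A 1" for g
    proof -
      have "[r] \<in> words N A 1" using r(1) by (simp add: words_def)
      then obtain d where d: "AE x in M. x \<in> Rset N A r \<longrightarrow> g x = d"
        using g unfolding Sspace_def by blast
      have "d = 0"
        by (rule L2_const_on_infinite[OF Sspace_L2[OF g] cylinder_sets inf d])
      have "AE x in M. cnj (g x) * h x = cnj 0 * 0"
        using d
      proof eventually_elim
        case (elim x)
        have "x \<in> cylinder N A [r, j0] \<Longrightarrow> x \<in> Rset N A r" by (auto simp: cylinder_def)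
        then show ?case using elim \<open>d = 0\<close> by (auto simp: h_def split: split_indicator)
      qed
      then have "l2_inner M g h = l2_inner M (\<lambda>x. 0) (\<lambda>x. 0)"
        by (intro l2_inner_cong_AE) (auto simp: L2_measurable Sspace_L2[OF g] Sspace_L2[OF h])
      then show ?thesis by (simp add: l2_inner_def)
    qed
    then have span: "in_closed_span M (mother_index N A) (\<lambda>(l, r). f l r) h"
      using mother_wavelet_basis[OF mw] h by (simp add: orthonormal_basis_iff ominus_def)
    \<comment> \<open>The integral over \<open>R\<^sub>r\<close> is not a continuous functional, but on \<open>L\<^sup>2\<close> functions constant
      on the \<open>R\<^sub>r\<^sub>j\<close> it agrees with the one over the part \<open>B\<close> of finite measure, which is.\<close>
    define F where "F = {j. j < N \<and> emeasure M (cylinder N A [r, j]) < \<infinity>}"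
    define B where "B = (\<Union>j\<in>F. cylinder N A [r, j])"
    have finF: "finite F" by (simp add: F_def)
    have B: "B \<in> sets M" unfolding B_def using finF by (intro sets.finite_UN) auto
    have "emeasure M B \<le> (\<Sum>j\<in>F. emeasure M (cylinder N A [r, j]))"
      unfolding B_def using finF by (intro emeasure_subadditive_finite) auto
    also have "\<dots> < \<infinity>" using finF by (auto simp: F_def)
    finally have BL2: "(indicator B :: _ \<Rightarrow> complex) \<in> L2 M"
      using B by (intro indicator_L2_finite)
    have "l2_inner M (indicator B) (f l r') = 0" if lr: "(l, r') \<in> mother_index N A" for l r'
    proof (cases "r' = r")
      case False
      have BR: "B \<subseteq> Rset N A r" unfolding B_def F_def by (auto simp: cylinder_def)
      have "l2_inner M (indicator B) (f l r') = (\<integral>x. 0 \<partial>M)"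
        unfolding l2_inner_def
        using mother_wavelet_support[OF mw lr] BR False
        by (intro Bochner_Integration.integral_cong refl) (force simp: in_Rset split: split_indicator)
      then show ?thesis by simp
    next
      case True
      have lr: "(l, r) \<in> mother_index N A" using lr True by simp
      note [measurable] = L2_measurable[OF mother_wavelet_L2[OF mw lr]] B
      have "AE x in M. \<forall>j\<in>{..<N} - F. x \<in> cylinder N A [r, j] \<longrightarrow> f l r x = 0"
        using zero_on_inf[OF lr] by (intro AE_finite_allI) (auto simp: F_def not_less top_unique)
      then have "AE x in M. cnj (indicator B x) * f l r x = indicator (Rset N A r) x *\<^sub>R f l r x"
        by eventually_elim (auto simp: B_def Rset_partition F_def split: split_indicator)
      then have "l2_inner M (indicator B) (f l r) = (LINT x : Rset N A r | M. f l r x)"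
        unfolding l2_inner_def set_lebesgue_integral_def by (intro integral_cong_AE) measurable
      also have "\<dots> = 0"
        using mw lr unfolding mother_wavelets_def by blast
      finally show ?thesis using True by simp
    qed
    then have "l2_inner M (indicator B) h = 0"
      using mother_wavelet_L2[OF mw] BL2
      by (intro closed_span_orthogonal[OF span Sspace_L2[OF h]]) auto
    moreover have "l2_inner M (indicator B) h = complex_of_real (measure M (cylinder N A [r, j0]))"
    proof -
      have "cylinder N A [r, j0] \<subseteq> B" using j0 by (auto simp: B_def F_def)
      then have "cnj (indicator B x) * h x = complex_of_real (indicator (cylinder N A [r, j0]) x)" for x
        by (auto simp: h_def split: split_indicator)
      then show ?thesis
        unfolding l2_inner_def by (simp add: Int_absorb2[OF cylinder_subset_Lam] del: of_real_indicator)
    qed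
    ultimately show False
      using j0(2,3) by (auto simp: measure_def enn2real_eq_0_iff)
  qed
qed

lemma finite_measure_of_mother_wavelets:
  assumes "mother_wavelets N A c f" "\<And>r. r < N \<Longrightarrow> A r r = 1"
  shows "finite_measure M"
proof (rule finite_measureI)
  have "space M = (\<Union>r<N. Rset N A r)"
    using Lam_step(1) by (auto simp: in_Rset)
  then have "emeasure M (space M) \<le> (\<Sum>r<N. emeasure M (Rset N A r))"
    by (simp only:) (intro emeasure_subadditive_finite, auto)
  also have "\<dots> < \<infinity>"
    using Rset_finite_measure[OF assms(1)] assms(2) by auto
  finally show "emeasure M (space M) \<noteq> \<infinity>" by simp
qed

end

section \<open>The wavelet spaces under the Cuntz--Krieger operators\<close>

context finite_admissible
begin

text \<open>The wavelet space of level \<open>k\<close>.\<close>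
abbreviation Wspace :: "nat \<Rightarrow> ((nat \<Rightarrow> nat) \<Rightarrow> complex) set" where
  "Wspace k \<equiv> ominus M (Sspace N A (k + 2)) (Sspace N A (k + 1))"

lemma Wspace_L2: "g \<in> Wspace k \<Longrightarrow> g \<in> L2 M"
  by (auto simp: ominus_def dest: Sspace_L2)

lemma Sop_Sspace:
  assumes i: "i < N" and h: "h \<in> Sspace N A k"
  shows "Sop N A i h \<in> Sspace N A (Suc k)"
proof -
  have "\<exists>d. AE x in M. x \<in> cylinder N A a \<longrightarrow> Sop N A i h x = d" if a: "a \<in> words N A (Suc k)" for a
  proof -
    obtain j b where jb: "a = j # b" using words_length[OF a] by (cases a) auto
    have b: "b \<in> words N A k" using words_ConsD a jb by blast
    show ?thesis
    proof (cases "j = i")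
      case False
      then have "x \<in> cylinder N A a \<longrightarrow> Sop N A i h x = 0" for x
        by (auto simp: jb in_cylinder_Cons Sop_def in_Rset split: split_indicator)
      then show ?thesis by blast
    next
      case True
      obtain d where "AE y in M. y \<in> cylinder N A b \<longrightarrow> h y = d"
        using h b unfolding Sspace_def by blast
      then have "AE y in M. y \<in> Dset N A i \<longrightarrow> y \<in> cylinder N A b \<longrightarrow> h y = d"
        by eventually_elim simp
      from AE_shift[OF i this] Sop_AE[OF i, of h]
      have "AE x in M. x \<in> cylinder N A a \<longrightarrow> Sop N A i h x = complex_of_real kappa * d"
      proof eventually_elim
        case (elim x)
        show ?case
        proof
          assume "x \<in> cylinder N A a"
          then have "x \<in> Lam N A \<and> x 0 = j \<and> shift x \<in> cylinder N A b"
            unfolding jb in_cylinder_Cons .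
          then have "x \<in> Rset N A i" "shift x \<in> cylinder N A b"
            unfolding in_Rset using True by auto
          then show "Sop N A i h x = complex_of_real kappa * d" using elim by simp
        qed
      qed
      then show ?thesis by blast
    qed
  qed
  then show ?thesis
    using Sop_L2[OF i Sspace_L2[OF h]] by (simp add: Sspace_def)
qed

text \<open>
  For \<open>k = 0\<close> this may fail: \<open>S\<^sub>i\<^sup>*\<close> maps the indicator of \<open>R\<^sub>i\<close> to a multiple of that of \<open>D\<^sub>i\<close>.
\<close>
lemma Tadj_Sspace:
  assumes i: "i < N" and g: "g \<in> Sspace N A (Suc k)" and k: "k > 0"
  shows "Tadj i g \<in> Sspace N A k"
proof -
  have "\<exists>d. AE y in M. y \<in> cylinder N A b \<longrightarrow> Tadj i g y = d" if b: "b \<in> words N A k" for b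
  proof -
    have "b \<noteq> []" using words_length[OF b] k by auto
    then have hd: "y 0 = hd b" if "y \<in> cylinder N A b" for y
      using that by (auto simp: cylinder_def hd_conv_nth)
    show ?thesis
    proof (cases "A i (hd b) = 1")
      case False
      then have "y \<in> cylinder N A b \<longrightarrow> Tadj i g y = 0" for y
        using hd by (auto simp: Tadj_def in_Dset)
      then show ?thesis by blast
    next
      case True
      then have "i # b \<in> words N A (Suc k)" using words_Cons[OF i b] by simp
      then obtain d where "AE x in M. x \<in> cylinder N A (i # b) \<longrightarrow> g x = d"
        using g unfolding Sspace_def by blast
      then have "AE x in M. x \<in> Rset N A i \<longrightarrow> x \<in> cylinder N A (i # b) \<longrightarrow> g x = d"
        by eventually_elim simp
      from AE_prepend[OF i this]
      have "AE y in M. y \<in> cylinder N A b \<longrightarrow> Tadj i g y = complex_of_real (1 / kappa) * d"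
      proof eventually_elim
        case (elim y)
        show ?case
        proof
          assume y: "y \<in> cylinder N A b"
          then have "y \<in> Dset N A i"
            using True hd[OF y] cylinder_subset_Lam by (auto simp: in_Dset)
          then show "Tadj i g y = complex_of_real (1 / kappa) * d"
            using elim y by (simp add: Tadj_def in_cylinder_prepend[OF i])
        qed
      qed
      then show ?thesis by blast
    qed
  qed
  then show ?thesis
    using Tadj_L2[OF i Sspace_L2[OF g]] by (simp add: Sspace_def)
qed

lemma Sop_Wspace:
  assumes i: "i < N" and h: "h \<in> Wspace k"
  shows "Sop N A i h \<in> Wspace (Suc k)"
proof -
  have hS: "h \<in> Sspace N A (k + 2)" and orth: "\<And>g. g \<in> Sspace N A (k + 1) \<Longrightarrow> l2_inner M g h = 0"
    using h by (auto simp: ominus_def)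
  have "l2_inner M g (Sop N A i h) = 0" if g: "g \<in> Sspace N A (Suc k + 1)" for g
  proof -
    have "l2_inner M (Sop N A i h) g = l2_inner M h (Tadj i g)"
      using Sop_adjoint[OF i Sspace_L2[OF hS] Sspace_L2[OF g]] .
    also have "l2_inner M (Tadj i g) h = 0"
      using g by (intro orth Tadj_Sspace i) auto
    then have "l2_inner M h (Tadj i g) = 0"
      using l2_inner_cnj[of M h "Tadj i g"] by simp
    finally show ?thesis using l2_inner_cnj[of M g "Sop N A i h"] by simp
  qed
  then show ?thesis
    using Sop_Sspace[OF i hS] by (simp add: ominus_def)
qed

lemma Tadj_Wspace:
  assumes i: "i < N" and g: "g \<in> Wspace (Suc k)"
  shows "Tadj i g \<in> Wspace k"
proof -
  have gS: "g \<in> Sspace N A (Suc k + 2)" and orth: "\<And>h. h \<in> Sspace N A (Suc k + 1) \<Longrightarrow> l2_inner M h g = 0"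
    using g by (auto simp: ominus_def)
  have "l2_inner M h (Tadj i g) = 0" if h: "h \<in> Sspace N A (k + 1)" for h
    using Sop_adjoint[OF i Sspace_L2[OF h] Sspace_L2[OF gS]] orth[of "Sop N A i h"] Sop_Sspace[OF i h]
    by simp
  then show ?thesis
    using Tadj_Sspace[OF i, of g "k + 2"] gS by (simp add: ominus_def)
qed

text \<open>The relation \<open>\<Sum>\<^sub>i S\<^sub>i S\<^sub>i\<^sup>* = 1\<close>.\<close>
lemma Sop_Tadj_sum: "AE x in M. g x = (\<Sum>i<N. Sop N A i (Tadj i g) x)"
proof -
  have "AE x in M. \<forall>i\<in>{..<N}. Sop N A i (Tadj i g) x = indicator (Rset N A i) x *\<^sub>R g x"
    using Sop_Tadj by (intro AE_finite_allI) auto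
  then show ?thesis
    using AE_space
  proof eventually_elim
    case (elim x)
    have "(\<Sum>i<N. Sop N A i (Tadj i g) x) = (\<Sum>i<N. if i = x 0 then g x else 0)"
      using elim by (intro sum.cong) (auto simp: in_Rset split: split_indicator)
    then show ?case using elim(2) Lam_step(1)[of x 0] by simp
  qed
qed

lemma Sop_diff: "Sop N A i (\<lambda>x. u x - v x) x = Sop N A i u x - Sop N A i v x"
  by (simp add: Sop_def right_diff_distrib)

lemma Sop_sum: "Sop N A i (\<lambda>x. \<Sum>j\<in>F. c j * u j x) x = (\<Sum>j\<in>F. c j * Sop N A i (u j) x)"
  unfolding Sop_def sum_distrib_left by (intro sum.cong refl) (simp only: mult_ac)

lemma closed_span_Sop:
  assumes i: "i < N" and g: "in_closed_span M I \<phi> g" "g \<in> L2 M"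
    and \<phi>: "\<And>j. j \<in> I \<Longrightarrow> \<phi> j \<in> L2 M"
  shows "in_closed_span M I (\<lambda>j. Sop N A i (\<phi> j)) (Sop N A i g)"
  unfolding in_closed_span_def
proof (intro allI impI)
  fix \<epsilon> :: real assume "\<epsilon> > 0"
  then obtain F c where F: "finite F" "F \<subseteq> I" "l2_norm M (\<lambda>x. g x - (\<Sum>j\<in>F. c j * \<phi> j x)) < \<epsilon>"
    using g(1) unfolding in_closed_span_def by blast
  have "l2_norm M (\<lambda>x. Sop N A i g x - (\<Sum>j\<in>F. c j * Sop N A i (\<phi> j) x))
      = l2_norm M (Sop N A i (\<lambda>x. g x - (\<Sum>j\<in>F. c j * \<phi> j x)))"
    unfolding Sop_sum[symmetric] Sop_diff[symmetric] ..
  also have "\<dots> \<le> l2_norm M (\<lambda>x. g x - (\<Sum>j\<in>F. c j * \<phi> j x))"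
    using F(2) \<phi> g(2) by (intro Sop_norm_le i L2_diff L2_sum L2_scale) auto
  finally show "\<exists>F c. finite F \<and> F \<subseteq> I \<and> l2_norm M (\<lambda>x. Sop N A i g x - (\<Sum>j\<in>F. c j * Sop N A i (\<phi> j) x)) < \<epsilon>"
    using F by (intro exI[of _ F] exI[of _ c]) auto
qed

section \<open>The wavelets\<close>

lemma Sword_Nil: "Sword N A [] u = u"
  by (simp add: Sword_def)

lemma Sword_Cons: "Sword N A (i # a) u = Sop N A i (Sword N A a u)"
  by (simp add: Sword_def)

lemma Sword_Wspace:
  assumes "u \<in> Wspace 0" "set a \<subseteq> {..<N}"
  shows "Sword N A a u \<in> Wspace (length a)"
  using assms(2)
proof (induction a)
  case Nil
  then show ?case using assms(1) by (simp add: Sword_Nil)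
next
  case (Cons i a)
  then have "Sop N A i (Sword N A a u) \<in> Wspace (Suc (length a))"
    by (intro Sop_Wspace) auto
  then show ?case by (simp add: Sword_Cons)
qed

lemma Sword_support:
  assumes "\<And>x. x \<in> Lam N A \<Longrightarrow> u x \<noteq> 0 \<Longrightarrow> x \<in> Rset N A r"
  shows "x \<in> Lam N A \<Longrightarrow> Sword N A a u x \<noteq> 0 \<Longrightarrow> x \<in> cylinder N A (a @ [r])"
proof (induction a arbitrary: x)
  case Nil
  then show ?case using assms by (simp add: Sword_Nil)
next
  case (Cons i a)
  then have "x \<in> Rset N A i" "Sword N A a u (shift x) \<noteq> 0"
    by (auto simp: Sword_Cons Sop_def split: split_indicator_asm)
  then show ?case
    using Cons.IH[OF shift_Lam[OF Cons.prems(1)]] by (simp add: in_cylinder_Cons in_Rset)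
qed

text \<open>
  \<open>S\<^sub>i\<close> is isometric on functions supported in \<open>D\<^sub>i\<close> only; admissibility of \<open>ar\<close> provides this
  at every letter of \<open>a\<close>.
\<close>
lemma Sword_inner:
  assumes uv: "u \<in> L2 M" "v \<in> L2 M"
    and supp: "\<And>x. x \<in> Lam N A \<Longrightarrow> u x \<noteq> 0 \<Longrightarrow> x \<in> Rset N A r"
  shows "a @ [r] \<in> words N A (Suc (length a)) \<Longrightarrow>
    Sword N A a u \<in> L2 M \<and> Sword N A a v \<in> L2 M \<and>
    l2_inner M (Sword N A a u) (Sword N A a v) = l2_inner M u v"
proof (induction a)
  case Nil
  then show ?case using uv by (simp add: Sword_Nil)
next
  case (Cons i a)
  have i: "i < N" and w: "a @ [r] \<in> words N A (Suc (length a))" and adm: "A i (hd (a @ [r])) = 1"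
    using words_ConsD[of i "a @ [r]" "Suc (length a)"] Cons.prems by auto
  note IH = Cons.IH[OF w]
  have "x \<in> Dset N A i" if "x \<in> Lam N A" "Sword N A a u x \<noteq> 0" for x
  proof -
    have "x \<in> cylinder N A (a @ [r])" using Sword_support[OF supp that] .
    then have "x 0 = hd (a @ [r])" by (auto simp: cylinder_def hd_conv_nth)
    then show ?thesis using that(1) adm by (simp add: in_Dset)
  qed
  then have "indicator (Dset N A i) x *\<^sub>R (cnj (Sword N A a u x) * Sword N A a v x)
      = cnj (Sword N A a u x) * Sword N A a v x" if "x \<in> space M" for x
    using that by (cases "Sword N A a u x = 0") auto
  then have "l2_inner M (Sop N A i (Sword N A a u)) (Sop N A i (Sword N A a v))
      = l2_inner M (Sword N A a u) (Sword N A a v)"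
    unfolding Sop_inner[OF i IH[THEN conjunct1, THEN L2_measurable] IH[THEN conjunct2, THEN conjunct1, THEN L2_measurable]]
    unfolding l2_inner_def by (rule Bochner_Integration.integral_cong[OF refl])
  then show ?case
    using IH i by (simp add: Sword_Cons Sop_L2)
qed

end

locale wavelet_system = finite_admissible +
  fixes c :: "nat \<Rightarrow> nat \<Rightarrow> nat \<Rightarrow> complex" and f :: "nat \<Rightarrow> nat \<Rightarrow> (nat \<Rightarrow> nat) \<Rightarrow> complex"
  assumes mw: "mother_wavelets N A c f"
begin

text \<open>The wavelets \<open>S\<^sub>a f\<^sup>l\<^sup>,\<^sup>r\<close>, for all triples \<open>(a, l, r)\<close>.\<close>
definition wav :: "nat list \<times> nat \<times> nat \<Rightarrow> (nat \<Rightarrow> nat) \<Rightarrow> complex" where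
  "wav = (\<lambda>(a, l, r). Sword N A a (f l r))"

lemma wav_index_D:
  assumes "(a, l, r) \<in> wavelet_index N A k"
  shows "length a = k" "set a \<subseteq> {..<N}" "(l, r) \<in> mother_index N A" "a @ [r] \<in> words N A (Suc k)"
  using assms by (auto simp: wavelet_index_def words_def)

lemma mother_Wspace: "(l, r) \<in> mother_index N A \<Longrightarrow> f l r \<in> Wspace 0"
  using mother_wavelet_basis[OF mw] by (fastforce simp: orthonormal_basis_iff numeral_2_eq_2)

lemma wav_Wspace:
  assumes "p \<in> wavelet_index N A k"
  shows "wav p \<in> Wspace k"
proof (cases p)
  case (fields a l r)
  then have "(a, l, r) \<in> wavelet_index N A k" using assms by simp
  note D = wav_index_D[OF this]
  show ?thesis
    using Sword_Wspace[OF mother_Wspace[OF D(3)] D(2)] D(1) by (simp add: wav_def fields)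
qed

lemma wav_L2: "p \<in> wavelet_index N A k \<Longrightarrow> wav p \<in> L2 M"
  using wav_Wspace Wspace_L2 by blast

lemma wav_support:
  assumes "(l, r) \<in> mother_index N A" "x \<in> Lam N A" "wav (a, l, r) x \<noteq> 0"
  shows "x \<in> cylinder N A (a @ [r])"
  using assms(2,3) by (intro Sword_support[where u = "f l r", OF mother_wavelet_support[OF mw assms(1)]]) (simp_all add: wav_def)

lemma wav_inadmissible:
  assumes "(l, r) \<in> mother_index N A" "a @ [r] \<notin> words N A (Suc (length a))" "x \<in> Lam N A"
  shows "wav (a, l, r) x = 0"
proof (rule ccontr)
  assume "wav (a, l, r) x \<noteq> 0"
  then have "a @ [r] = map x [0..<Suc (length a)]"
    using wav_support[OF assms(1,3)] in_cylinder_iff_prefix[of "a @ [r]" "Suc (length a)" x] by simp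
  then show False
    using prefix_in_words[OF assms(3)] assms(2) by metis
qed

lemma wav_orthonormal_level:
  assumes "p \<in> wavelet_index N A k" "q \<in> wavelet_index N A k"
  shows "l2_inner M (wav p) (wav q) = (if p = q then 1 else 0)"
proof -
  obtain a l r b m s where pq: "p = (a, l, r)" "q = (b, m, s)" by (metis prod.exhaust)
  have p: "(a, l, r) \<in> wavelet_index N A k" and q: "(b, m, s) \<in> wavelet_index N A k"
    using assms pq by auto
  note P = wav_index_D[OF p] and Q = wav_index_D[OF q]
  show ?thesis
  proof (cases "a = b \<and> r = s")
    case True
    have s: "(m, r) \<in> mother_index N A" using Q(3) True by simp
    have "l2_inner M (wav p) (wav q) = l2_inner M (f l r) (f m r)"
      using Sword_inner[OF mother_wavelet_L2[OF mw P(3)] mother_wavelet_L2[OF mw s]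
          mother_wavelet_support[OF mw P(3)], of a] P(1,4) True
      by (simp add: pq wav_def)
    then show ?thesis
      using mother_wavelet_inner[OF mw P(3) s] True by (simp add: pq)
  next
    case False
    have "cnj (wav p x) * wav q x = 0" if x: "x \<in> space M" for x
    proof (rule ccontr)
      assume "cnj (wav p x) * wav q x \<noteq> 0"
      then have "x \<in> cylinder N A (a @ [r])" "x \<in> cylinder N A (b @ [s])"
        using x wav_support[OF P(3)] wav_support[OF Q(3)] by (auto simp: pq)
      then have "a @ [r] = b @ [s]"
        using in_cylinder_iff_prefix[of "a @ [r]" "Suc k" x] in_cylinder_iff_prefix[of "b @ [s]" "Suc k" x] P(1) Q(1)
        by auto
      then show False using False by simp
    qed
    then have "l2_inner M (wav p) (wav q) = (\<integral>x. 0 \<partial>M)"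
      unfolding l2_inner_def by (intro Bochner_Integration.integral_cong refl)
    then show ?thesis using False by (auto simp: pq)
  qed
qed

text \<open>
  By induction on the level: \<open>g = \<Sum>\<^sub>i S\<^sub>i (S\<^sub>i\<^sup>* g)\<close> where \<open>S\<^sub>i\<^sup>* g\<close> lies one level below, and
  \<open>S\<^sub>i\<close> maps a wavelet to a wavelet of the next level or to zero.
\<close>
lemma wav_span_level:
  "g \<in> Wspace k \<Longrightarrow> in_closed_span M (wavelet_index N A k) wav g"
proof (induction k arbitrary: g)
  case 0
  have "in_closed_span M (mother_index N A) (\<lambda>(l, r). f l r) g"
    using mother_wavelet_basis[OF mw] 0 by (simp add: orthonormal_basis_iff numeral_2_eq_2)
  then show ?case
  proof (rule closed_span_trans)
    fix p assume "p \<in> mother_index N A"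
    then obtain l r where p: "p = (l, r)" "(l, r) \<in> mother_index N A" by (cases p) auto
    then have "([], l, r) \<in> wavelet_index N A 0"
      by (auto simp: wavelet_index_def words_def mother_index_def)
    from closed_span_base[OF this, of M wav]
    show "in_closed_span M (wavelet_index N A 0) wav (case p of (l, r) \<Rightarrow> f l r)"
      by (simp add: p wav_def Sword_Nil)
  qed (use 0 Wspace_L2 wav_L2 mother_wavelet_L2[OF mw] in auto)
next
  case (Suc k)
  have T: "Tadj i g \<in> Wspace k" if "i < N" for i
    by (rule Tadj_Wspace[OF that Suc.prems])
  have "in_closed_span M (wavelet_index N A (Suc k)) wav (Sop N A i (Tadj i g))" if i: "i < N" for i
  proof (rule closed_span_trans)
    show "in_closed_span M (wavelet_index N A k) (\<lambda>p. Sop N A i (wav p)) (Sop N A i (Tadj i g))"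
      using T[OF i] by (intro closed_span_Sop i Suc.IH wav_L2 Wspace_L2)
    show "Sop N A i (Tadj i g) \<in> L2 M"
      by (intro Sop_L2 i Wspace_L2[OF T])
    fix p assume p: "p \<in> wavelet_index N A k"
    show L: "Sop N A i (wav p) \<in> L2 M" by (intro Sop_L2 i wav_L2[OF p])
    obtain a l r where alr: "p = (a, l, r)" by (metis prod.exhaust)
    note P = wav_index_D[OF p[unfolded alr]]
    have S: "Sop N A i (wav p) = wav (i # a, l, r)"
      by (simp add: alr wav_def Sword_Cons)
    show "in_closed_span M (wavelet_index N A (Suc k)) wav (Sop N A i (wav p))"
    proof (cases "(i # a) @ [r] \<in> words N A (Suc (Suc k))")
      case True
      then have "i # a \<in> words N A (Suc k)"
        using words_take[OF True, of "Suc k"] P(1) by simp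
      then have "(i # a, l, r) \<in> wavelet_index N A (Suc k)"
        using True P(3) by (simp add: wavelet_index_def)
      then show ?thesis unfolding S by (rule closed_span_base)
    next
      case False
      then have "AE x in M. Sop N A i (wav p) x = 0"
        unfolding S using P(1) by (intro AE_I2 wav_inadmissible P(3)) auto
      then show ?thesis using L2_measurable[OF L] by (rule closed_span_null)
    qed
  qed (rule wav_L2)
  moreover have ST: "Sop N A i (Tadj i g) \<in> L2 M" if "i \<in> {..<N}" for i
    using that Wspace_L2[OF T] by (intro Sop_L2) simp_all
  ultimately have "in_closed_span M (wavelet_index N A (Suc k)) wav (\<lambda>x. \<Sum>i<N. Sop N A i (Tadj i g) x)"
    by (intro closed_span_sum wav_L2) simp_all
  then show ?case
    by (rule closed_span_cong_AE[OF _ wav_L2 Wspace_L2[OF Suc.prems] L2_sum[OF ST] Sop_Tadj_sum])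
qed

lemma wav_basis_level: "orthonormal_basis M (wavelet_index N A k) wav (Wspace k)"
  unfolding orthonormal_basis_iff using wav_Wspace wav_orthonormal_level wav_span_level by blast

lemma wav_orth_Sspace:
  assumes "p \<in> wavelet_index N A k" "g \<in> Sspace N A m" "m \<le> k + 1"
  shows "l2_inner M g (wav p) = 0"
  using wav_Wspace[OF assms(1)] Sspace_mono[OF assms(2,3)] by (simp add: ominus_def)

lemma wav_orthonormal:
  assumes p: "p \<in> wavelet_index N A k" and q: "q \<in> wavelet_index N A m"
  shows "l2_inner M (wav p) (wav q) = (if p = q then 1 else 0)"
proof -
  have len: "length (fst p') = k'" if "p' \<in> wavelet_index N A k'" for p' k'
    using that by (auto simp: wavelet_index_def words_def)
  have S: "wav p' \<in> Sspace N A (k' + 2)" if "p' \<in> wavelet_index N A k'" for p' k'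
    using wav_Wspace[OF that] by (simp add: ominus_def)
  consider "k = m" | "k < m" | "m < k" by linarith
  then show ?thesis
  proof cases
    case 1
    then show ?thesis using wav_orthonormal_level p q by simp
  next
    case 2
    then show ?thesis using wav_orth_Sspace[OF q S[OF p]] len[OF p] len[OF q] by auto
  next
    case 3
    then have "l2_inner M (wav q) (wav p) = 0" using wav_orth_Sspace[OF p S[OF q]] by simp
    then show ?thesis using l2_inner_cnj[of M "wav p" "wav q"] 3 len[OF p] len[OF q] by auto
  qed
qed

text \<open>
  The projection of \<open>g\<close> onto \<open>\<SS>\<^sub>1\<close> is zero, and consecutive projections differ by an element
  of a wavelet space, so the projection onto each \<open>\<SS>\<^sub>k\<close> is in the span of the wavelets.
\<close>
lemma wav_span_L2:
  assumes g: "g \<in> ominus M (L2 M) (Sspace N A 1)"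
  shows "in_closed_span M (\<Union>k. wavelet_index N A k) wav g"
proof (rule closed_span_limit)
  have gL: "g \<in> L2 M" and orth: "\<And>h. h \<in> Sspace N A 1 \<Longrightarrow> l2_inner M h g = 0"
    using g by (auto simp: ominus_def)
  show "g \<in> L2 M" by (rule gL)
  show J: "wav p \<in> L2 M" if "p \<in> (\<Union>k. wavelet_index N A k)" for p
    using that wav_L2 by blast
  note PL = Sspace_L2[OF Proj_Sspace]
  have P: "in_closed_span M (\<Union>k. wavelet_index N A k) wav (Proj (Suc k) g)" for k
  proof (induction k)
    case 0
    have "l2_inner M (indicator (cylinder N A b)) g = 0" if "b \<in> words N A (Suc 0)" for b
      using words_length[OF that] by (intro orth indicator_Sspace) simp
    then have "Proj (Suc 0) g = (\<lambda>x. 0)"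
      by (simp add: Proj_def fun_eq_iff)
    then show ?case by (simp add: closed_span_null)
  next
    case (Suc k)
    let ?d = "\<lambda>x. Proj (k + 2) g x - Proj (k + 1) g x"
    have "l2_inner M h ?d = 0" if h: "h \<in> Sspace N A (k + 1)" for h
    proof -
      have "l2_inner M h ?d = l2_inner M h (\<lambda>x. (g x - Proj (k + 1) g x) - (g x - Proj (k + 2) g x))"
        by simp
      also have "\<dots> = l2_inner M h (\<lambda>x. g x - Proj (k + 1) g x) - l2_inner M h (\<lambda>x. g x - Proj (k + 2) g x)"
        by (intro l2_inner_diff_right Sspace_L2[OF h] L2_diff gL PL)
      also have "\<dots> = 0"
        using Proj_orth[OF gL h] Proj_orth[OF gL Sspace_mono[OF h, of "k + 2"]] by simp
      finally show ?thesis .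
    qed
    moreover have "?d \<in> Sspace N A (k + 2)"
      by (intro Sspace_diff Proj_Sspace Sspace_mono[OF Proj_Sspace[of "k + 1" g]]) simp
    ultimately have d: "?d \<in> Wspace k"
      unfolding ominus_def by blast
    have "in_closed_span M (\<Union>k. wavelet_index N A k) wav (\<lambda>x. Proj (Suc k) g x + ?d x)"
    proof (rule closed_span_add[OF _ PL Wspace_L2[OF d] Suc])
      show "in_closed_span M (\<Union>k. wavelet_index N A k) wav ?d"
        by (rule closed_span_mono[OF wav_span_level[OF d]]) blast
    qed (rule J)
    then show ?case by simp
  qed
  fix \<epsilon> :: real assume "\<epsilon> > 0"
  then obtain k where "l2_norm M (\<lambda>x. g x - Proj (Suc k) g x) < \<epsilon>"
    using Proj_tendsto[OF gL] by blast
  then show "\<exists>h\<in>L2 M. in_closed_span M (\<Union>k. wavelet_index N A k) wav h \<and> l2_norm M (\<lambda>x. g x - h x) < \<epsilon>"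
    using P[of k] PL[of "Suc k" g] by blast
qed

lemma wav_basis: "orthonormal_basis M (\<Union>k. wavelet_index N A k) wav (ominus M (L2 M) (Sspace N A 1))"
  unfolding orthonormal_basis_iff
proof (intro conjI ballI)
  fix p assume "p \<in> (\<Union>k. wavelet_index N A k)"
  then obtain k where k: "p \<in> wavelet_index N A k" by blast
  show "wav p \<in> ominus M (L2 M) (Sspace N A 1)"
    using wav_L2[OF k] wav_orth_Sspace[OF k] by (simp add: ominus_def)
  fix q assume "q \<in> (\<Union>k. wavelet_index N A k)"
  then show "l2_inner M (wav p) (wav q) = (if p = q then 1 else 0)"
    using wav_orthonormal[OF k] by blast
qed (rule wav_span_L2)

lemma wav_basis_extend:
  assumes e: "orthonormal_basis M I e (Sspace N A 1)"
  shows "orthonormal_basis M (I <+> (\<Union>k. wavelet_index N A k)) (case_sum e wav) (L2 M)"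
proof -
  let ?J = "\<Union>k. wavelet_index N A k"
  have eS: "\<And>i. i \<in> I \<Longrightarrow> e i \<in> Sspace N A 1" using e by (simp add: orthonormal_basis_iff)
  have wL: "\<And>p. p \<in> ?J \<Longrightarrow> wav p \<in> L2 M" using wav_L2 by blast
  have L: "case_sum e wav s \<in> L2 M" if "s \<in> I <+> ?J" for s
    using that by (elim PlusE) (simp_all add: Sspace_L2[OF eS] wL del: UN_iff)
  have cross: "l2_inner M (e i) (wav p) = 0" if "i \<in> I" "p \<in> ?J" for i p
  proof -
    from that(2) obtain k where "p \<in> wavelet_index N A k" by blast
    then show ?thesis using wav_orth_Sspace[OF _ eS[OF that(1)]] by simp
  qed
  have cross': "l2_inner M (wav p) (e i) = 0" if "i \<in> I" "p \<in> ?J" for i p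
    using cross[OF that] l2_inner_cnj[of M "wav p" "e i"] by simp
  have orth: "l2_inner M (case_sum e wav s) (case_sum e wav t) = (if s = t then 1 else 0)"
    if "s \<in> I <+> ?J" "t \<in> I <+> ?J" for s t
  proof -
    have "l2_inner M (e i) (e j) = (if i = j then 1 else 0)" if "i \<in> I" "j \<in> I" for i j
      using e that by (simp add: orthonormal_basis_iff)
    moreover have "l2_inner M (wav p) (wav q) = (if p = q then 1 else 0)" if "p \<in> ?J" "q \<in> ?J" for p q
      using that wav_orthonormal by blast
    ultimately show ?thesis
      using that cross cross' by (elim PlusE) (simp_all del: UN_iff)
  qed
  have "in_closed_span M (I <+> ?J) (case_sum e wav) g" if g: "g \<in> L2 M" for g
  proof -
    note PL = Sspace_L2[OF Proj_Sspace]
    let ?d = "\<lambda>x. g x - Proj 1 g x"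
    have "in_closed_span M I e (Proj 1 g)"
      using e Proj_Sspace by (auto simp: orthonormal_basis_iff)
    then have 1: "in_closed_span M (I <+> ?J) (case_sum e wav) (Proj 1 g)"
    proof (rule closed_span_trans[OF _ PL])
      show "in_closed_span M (I <+> ?J) (case_sum e wav) (e i)" if "i \<in> I" for i
        using closed_span_base[of "Inl i" "I <+> ?J" M "case_sum e wav"] that by auto
    qed (use eS Sspace_L2 L in auto)
    have d: "?d \<in> ominus M (L2 M) (Sspace N A 1)"
      using g PL Proj_orth[OF g] by (simp add: ominus_def L2_diff)
    have 2: "in_closed_span M (I <+> ?J) (case_sum e wav) ?d"
    proof (rule closed_span_trans[OF wav_span_L2[OF d]])
      show "in_closed_span M (I <+> ?J) (case_sum e wav) (wav p)" if "p \<in> ?J" for p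
        using closed_span_base[of "Inr p" "I <+> ?J" M "case_sum e wav"] that by auto
    qed (use wL L L2_diff[OF g PL] in auto)
    have "in_closed_span M (I <+> ?J) (case_sum e wav) (\<lambda>x. Proj 1 g x + ?d x)"
      using 1 2 by (intro closed_span_add L PL L2_diff g)
    then show ?thesis by simp
  qed
  then show ?thesis
    unfolding orthonormal_basis_iff using L orth by blast
qed

end

section \<open>The orthonormal basis of wavelets\<close>

theorem theorem3p2:
  fixes N :: nat
    and A :: "nat \<Rightarrow> nat \<Rightarrow> nat"
    and c :: "nat \<Rightarrow> nat \<Rightarrow> nat \<Rightarrow> complex"
    and f :: "nat \<Rightarrow> nat \<Rightarrow> (nat \<Rightarrow> nat) \<Rightarrow> complex"
    and \<psi> :: "nat list \<times> nat \<times> nat \<Rightarrow> (nat \<Rightarrow> nat) \<Rightarrow> complex"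
  assumes "N > 0"
    and "\<And>i j. i < N \<Longrightarrow> j < N \<Longrightarrow> A i j \<in> {0, 1}"
    and "\<And>i. i < N \<Longrightarrow> A i i = 1"
    and "mother_wavelets N A c f"
    and "\<psi> = (\<lambda>(a, l, r). Sword N A a (f l r))"
  shows "(\<forall>k. \<forall>a \<in> words N A k. \<forall>(l, r) \<in> mother_index N A.
            (a, l, r) \<notin> wavelet_index N A k \<longrightarrow> (AE x in mu N A. \<psi> (a, l, r) x = 0)) \<and>
         (\<forall>k. orthonormal_basis (mu N A) (wavelet_index N A k) \<psi>
            (ominus (mu N A) (Sspace N A (k + 2)) (Sspace N A (k + 1)))) \<and>
         orthonormal_basis (mu N A) (\<Union>k. wavelet_index N A k) \<psi>
            (ominus (mu N A) (L2 (mu N A)) (Sspace N A 1)) \<and>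
         (\<forall>(I :: nat set) e. orthonormal_basis (mu N A) I e (Sspace N A 1) \<longrightarrow>
            orthonormal_basis (mu N A) (I <+> (\<Union>k. wavelet_index N A k)) (case_sum e \<psi>)
              (L2 (mu N A)))"
proof -
  interpret admissible N A using assms(1) by unfold_locales
  interpret finite_measure "mu N A"
    using finite_measure_of_mother_wavelets[OF assms(4,3)] .
  interpret wavelet_system N A c f using assms(4) by unfold_locales
  have \<psi>: "\<psi> = wav" unfolding wav_def by (rule assms(5))
  have "AE x in mu N A. wav (a, l, r) x = 0"
    if "a \<in> words N A k" "(l, r) \<in> mother_index N A" "(a, l, r) \<notin> wavelet_index N A k" for k a l r
    using that words_length[OF that(1)]
    by (intro AE_I2 wav_inadmissible) (auto simp: wavelet_index_def)
  then show ?thesis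
    unfolding \<psi> using wav_basis_level wav_basis wav_basis_extend by blast
qed

end
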